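(* The linear map $\psi$ defined by the images $\psi([x_J])=\chi_J$, $J\subseteq\Pi$, is an isomorphism from the new descent algebra $\sum_W(A_n)$ to $G(W(A_n))$.
   Context: Let $e_1,\dots,e_{n+1}$ be an orthonormal basis of a Euclidean space of dimension $n+1$. The root system of type $A_n$ is $\Phi=\{e_i-e_j\mid i\ne j,\ i,j=1,\dots,n+1\}$ with fundamental system $\Pi=\{e_1-e_2,\dots,e_n-e_{n+1}\}$ and corresponding positive system $\Phi^+$; the Weyl group $W=W(A_n)$ is the group generated by the reflections $w_r$, $r\in\Phi$. For $J\subseteq\Pi$, $W_J$ is the standard parabolic subgroup generated by the $w_r$, $r\in J$, and $X_J=\{w\in W\mid w(J)\subseteq\Phi^+\}$ is the set of distinguished representatives of the left cosets $wW_J$ in $W$. Put $X_J^{-1}=\{w^{-1}\mid w\in X_J\}$ and $X_{JK}=X_J^{-1}\cap X_K$, a set of distinguished representatives of the double cosets $W_JwW_K$. Let $x_J=\sum_{d\in X_J}d$. For $J,K,L\subseteq\Pi$, $a_{JKL}$ is the number of elements $w\in X_{JK}$ such that $w^{-1}(J)\cap K=L$. Write $J\sim K$ if $w(J)=K$ for some $w\in W$; define $x_J\sim x_K$ if and only if $J\sim K$, and let $[x_J]=\{x_K\mid K\subseteq\Pi,\ x_K\sim x_J\}$ be the equivalence class of $x_J$. The new descent algebra $\sum_W(A_n)$ is the algebra over the field of rationals $\mathbb{Q}$ having as basis the distinct classes $[x_J]$, $J\subseteq\Pi$, with multiplication $[x_J][x_K]=\sum_{L\subseteq K}a_{JKL}[x_L]$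 and identity $[x_\Pi]$. For $J\subseteq\Pi$, $\chi_J$ is the permutation character of $W=W(A_n)$ acting on the left cosets of $W_J$, and $G(W)$ is the $\mathbb{Z}$-module (of class functions on $W$) generated by all $\chi_J$, $J\subseteq\Pi$; it is regarded as a ring of class functions.
   Formalization: Since a Q-algebra cannot map isomorphically onto the Z-module G(W) (½[x_Π] goes to ½), the target is taken to be the rational span of the χ_J; in addition ψ is shown to carry the Z-span of the classes [x_J] onto G(W), a subring. *)

theory Defs
  imports "HOL-Analysis.Euclidean_Space" 
    "HOL-Algebra.Bij" "HOL-Algebra.Left_Coset" "HOL-Algebra.Generated_Groups"
    "HOL-Algebra.Module" "HOL-Algebra.Subrings"
begin

unbundle inner_syntax

section \<open>Roots, Weyl groups and distinguished coset representatives\<close>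

definition reflection :: "'a::real_inner \<Rightarrow> 'a \<Rightarrow> 'a" where
  "reflection r v = v - (2 * (v \<bullet> r) / (r \<bullet> r)) *\<^sub>R r"

text \<open>For the set of all roots this is the Weyl group \<open>W\<close>; for a set \<open>J\<close> of
  simple roots it is the standard parabolic subgroup \<open>W\<^sub>J\<close>.\<close>

definition refl_group :: "'a::real_inner set \<Rightarrow> ('a \<Rightarrow> 'a) set" where
  "refl_group S = generate (BijGroup UNIV) (reflection ` S)"

definition weyl :: "'a::real_inner set \<Rightarrow> ('a \<Rightarrow> 'a) monoid" where
  "weyl \<Phi> = (BijGroup UNIV)\<lparr>carrier := refl_group \<Phi>\<rparr>"

definition typeA_roots :: "(nat \<Rightarrow> 'a::real_inner) \<Rightarrow> nat \<Rightarrow> 'a set" where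
  "typeA_roots e n = {e i - e j | i j. i \<in> {1..n+1} \<and> j \<in> {1..n+1} \<and> i \<noteq> j}"

definition typeA_simple :: "(nat \<Rightarrow> 'a::real_inner) \<Rightarrow> nat \<Rightarrow> 'a set" where
  "typeA_simple e n = {e i - e (i + 1) | i. i \<in> {1..n}}"

definition pos_roots :: "'a::real_inner set \<Rightarrow> 'a set \<Rightarrow> 'a set" where
  "pos_roots \<Phi> \<Delta> = {r \<in> \<Phi>. \<exists>c. (\<forall>s\<in>\<Delta>. 0 \<le> c s) \<and> r = (\<Sum>s\<in>\<Delta>. c s *\<^sub>R s)}"

definition dist_reps :: "'a::real_inner set \<Rightarrow> 'a set \<Rightarrow> 'a set \<Rightarrow> ('a \<Rightarrow> 'a) set" where
  "dist_reps \<Phi> \<Delta> J = {w \<in> refl_group \<Phi>. w ` J \<subseteq> pos_roots \<Phi> \<Delta>}"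

definition double_reps ::
    "'a::real_inner set \<Rightarrow> 'a set \<Rightarrow> 'a set \<Rightarrow> 'a set \<Rightarrow> ('a \<Rightarrow> 'a) set" where
  "double_reps \<Phi> \<Delta> J K = inv_into UNIV ` dist_reps \<Phi> \<Delta> J \<inter> dist_reps \<Phi> \<Delta> K"

text \<open>The numbers \<open>a\<^bsub>JKL\<^esub>\<close>.\<close>

definition struct_const ::
    "'a::real_inner set \<Rightarrow> 'a set \<Rightarrow> 'a set \<Rightarrow> 'a set \<Rightarrow> 'a set \<Rightarrow> nat" where
  "struct_const \<Phi> \<Delta> J K L =
     card {w \<in> double_reps \<Phi> \<Delta> J K. inv_into UNIV w ` J \<inter> K = L}"

section \<open>The new descent algebra\<close>

text \<open>The element \<open>x\<^sub>J\<close> of the rational group algebra of \<open>W\<close>, given by its coefficient function.\<close>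

definition x_elem :: "'a::real_inner set \<Rightarrow> 'a set \<Rightarrow> 'a set \<Rightarrow> ('a \<Rightarrow> 'a) \<Rightarrow> rat" where
  "x_elem \<Phi> \<Delta> J = (\<lambda>w. of_bool (w \<in> dist_reps \<Phi> \<Delta> J))"

definition W_conj :: "'a::real_inner set \<Rightarrow> 'a set \<Rightarrow> 'a set \<Rightarrow> bool" where
  "W_conj \<Phi> J K \<longleftrightarrow> (\<exists>w\<in>refl_group \<Phi>. w ` J = K)"

definition x_class ::
    "'a::real_inner set \<Rightarrow> 'a set \<Rightarrow> 'a set \<Rightarrow> (('a \<Rightarrow> 'a) \<Rightarrow> rat) set" where
  "x_class \<Phi> \<Delta> J = {x_elem \<Phi> \<Delta> K | K. K \<subseteq> \<Delta> \<and> W_conj \<Phi> K J}"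

definition x_classes :: "'a::real_inner set \<Rightarrow> 'a set \<Rightarrow> (('a \<Rightarrow> 'a) \<Rightarrow> rat) set set" where
  "x_classes \<Phi> \<Delta> = x_class \<Phi> \<Delta> ` Pow \<Delta>"

text \<open>Elements of the algebra are coefficient functions on classes; this is the basis vector \<open>[x\<^sub>J]\<close>.\<close>

definition class_vec ::
    "'a::real_inner set \<Rightarrow> 'a set \<Rightarrow> 'a set \<Rightarrow> (('a \<Rightarrow> 'a) \<Rightarrow> rat) set \<Rightarrow> rat" where
  "class_vec \<Phi> \<Delta> J = (\<lambda>c. of_bool (c = x_class \<Phi> \<Delta> J))"

text \<open>The right-hand side of the multiplication rule for \<open>[x\<^sub>J][x\<^sub>K]\<close>, as a function of \<open>J\<close>
  and \<open>K\<close>. That it depends only on the two classes is not built in: the product below uses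
  chosen representatives, so the rule for arbitrary \<open>J\<close> and \<open>K\<close> is a theorem.\<close>

definition class_prod ::
    "'a::real_inner set \<Rightarrow> 'a set \<Rightarrow> 'a set \<Rightarrow> 'a set \<Rightarrow> (('a \<Rightarrow> 'a) \<Rightarrow> rat) set \<Rightarrow> rat" where
  "class_prod \<Phi> \<Delta> J K =
     (\<lambda>c. \<Sum>L\<in>Pow K. of_nat (struct_const \<Phi> \<Delta> J K L) * class_vec \<Phi> \<Delta> L c)"

definition class_rep ::
    "'a::real_inner set \<Rightarrow> 'a set \<Rightarrow> (('a \<Rightarrow> 'a) \<Rightarrow> rat) set \<Rightarrow> 'a set" where
  "class_rep \<Phi> \<Delta> c = (SOME J. J \<subseteq> \<Delta> \<and> x_class \<Phi> \<Delta> J = c)"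

definition new_descent_algebra ::
    "'a::real_inner set \<Rightarrow> 'a set \<Rightarrow> (rat, (('a \<Rightarrow> 'a) \<Rightarrow> rat) set \<Rightarrow> rat) module" where
  "new_descent_algebra \<Phi> \<Delta> =
     \<lparr>carrier = {u. \<forall>c. c \<notin> x_classes \<Phi> \<Delta> \<longrightarrow> u c = 0},
      monoid.mult = (\<lambda>u v b. \<Sum>c\<in>x_classes \<Phi> \<Delta>. \<Sum>d\<in>x_classes \<Phi> \<Delta>.
                u c * v d * class_prod \<Phi> \<Delta> (class_rep \<Phi> \<Delta> c) (class_rep \<Phi> \<Delta> d) b),
      one = class_vec \<Phi> \<Delta> \<Delta>,
      zero = (\<lambda>c. 0),
      add = (\<lambda>u v c. u c + v c),
      module.smult = (\<lambda>q u c. q * u c)\<rparr>"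

section \<open>Permutation characters\<close>

text \<open>Functions on \<open>W\<close> are extended by 0 outside \<open>W\<close>.\<close>

definition perm_char :: "'a::real_inner set \<Rightarrow> 'a set \<Rightarrow> ('a \<Rightarrow> 'a) \<Rightarrow> rat" where
  "perm_char \<Phi> J = (\<lambda>w. if w \<in> refl_group \<Phi>
     then of_nat (card {C \<in> lcosets\<^bsub>weyl \<Phi>\<^esub> (refl_group J). w <#\<^bsub>weyl \<Phi>\<^esub> C = C})
     else 0)"

text \<open>All combinations of the \<open>\<chi>\<^sub>J\<close> with coefficients in \<open>A\<close>: for \<open>A = \<int>\<close> this is the
  \<open>\<int>\<close>-module \<open>G(W)\<close>, for \<open>A = UNIV\<close> its rational span.\<close>

definition perm_char_span ::
    "rat set \<Rightarrow> 'a::real_inner set \<Rightarrow> 'a set \<Rightarrow> (('a \<Rightarrow> 'a) \<Rightarrow> rat) set" where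
  "perm_char_span A \<Phi> \<Delta> =
     {(\<lambda>w. \<Sum>J\<in>Pow \<Delta>. a J * perm_char \<Phi> J w) | a. \<forall>J. a J \<in> A}"

definition perm_char_algebra ::
    "'a::real_inner set \<Rightarrow> 'a set \<Rightarrow> (rat, ('a \<Rightarrow> 'a) \<Rightarrow> rat) module" where
  "perm_char_algebra \<Phi> \<Delta> =
     \<lparr>carrier = perm_char_span UNIV \<Phi> \<Delta>,
      monoid.mult = (\<lambda>f g w. f w * g w),
      one = (\<lambda>w. of_bool (w \<in> refl_group \<Phi>)),
      zero = (\<lambda>w. 0),
      add = (\<lambda>f g w. f w + g w),
      module.smult = (\<lambda>q f w. q * f w)\<rparr>"

section \<open>Linear maps\<close>

definition rat_ring :: "rat ring" where
  "rat_ring = \<lparr>carrier = UNIV, monoid.mult = (*), one = 1, zero = 0, add = (+)\<rparr>"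

definition linear_maps ::
    "('r, 'k) ring_scheme \<Rightarrow> ('r, 'm, 'x) module_scheme \<Rightarrow> ('r, 'n, 'y) module_scheme
      \<Rightarrow> ('m \<Rightarrow> 'n) set" where
  "linear_maps R M N = {f \<in> carrier M \<rightarrow> carrier N.
     (\<forall>u\<in>carrier M. \<forall>v\<in>carrier M. f (u \<oplus>\<^bsub>M\<^esub> v) = f u \<oplus>\<^bsub>N\<^esub> f v) \<and>
     (\<forall>q\<in>carrier R. \<forall>u\<in>carrier M. f (q \<odot>\<^bsub>M\<^esub> u) = q \<odot>\<^bsub>N\<^esub> f u)}"

end

theory Submission
  imports Defs "HOL-Combinatorics.Permutations" "HOL-Analysis.Linear_Algebra"
begin

text \<open>
  The characters \<open>\<chi>\<^sub>J\<close> and the classes \<open>[x\<^sub>J]\<close> multiply by the same rule. The fixed points of \<open>w\<close> on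
  \<open>W/W\<^sub>J \<times> W/W\<^sub>K\<close> split according to the orbits of \<open>W\<close>, which correspond to the double cosets
  \<open>W\<^sub>J d W\<^sub>K\<close>, and the orbit of \<open>d\<close> is isomorphic to the set of left cosets of
  \<open>W\<^sub>K \<inter> d\<^sup>-\<^sup>1 W\<^sub>J d\<close> (\<open>card_fixed_lcosets_mult\<close>). For the distinguished representative \<open>d\<close> of a double
  coset this group is again parabolic, namely \<open>W\<^sub>L\<close> with \<open>L = d\<^sup>-\<^sup>1(J) \<inter> K\<close>
  (\<open>parabolic_inter_conjugate\<close>). Counting the \<open>d\<close> with a given \<open>L\<close> yields
  \<open>\<chi>\<^sub>J \<chi>\<^sub>K = \<Sum>\<^sub>L a\<^bsub>JKL\<^esub> \<chi>\<^sub>L\<close> (\<open>perm_char_product\<close>).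

  Conjugate subgroups have the same permutation character (\<open>perm_char_W_conj\<close>), so \<open>[x\<^sub>J] \<mapsto> \<chi>\<^sub>J\<close>
  extends to a linear map, which is onto the span of the characters and carries the product of the
  descent algebra to the pointwise product. It is injective because the characters of different classes are
  linearly independent: a Coxeter element \<open>c\<close> of \<open>W\<^sub>J\<close> satisfies \<open>\<chi>\<^sub>J(c) \<noteq> 0\<close>, and it has a fixed point on
  \<open>W/W\<^sub>K\<close> only if some \<open>w \<in> W\<close> maps \<open>J\<close> into \<open>K\<close>. If the classes are ordered by the size of \<open>J\<close>, the
  matrix of these values is therefore triangular with nonzero diagonal (\<open>ex_char_separating_element\<close>).
  The ring laws of the descent algebra, and the independence of its product from the chosen
  representatives, then follow by transport along this injection from the corresponding facts on functions.

  The properties of \<open>W\<close> that enter are proved for permutations of \<open>{1..N}\<close>, \<open>N = n + 1\<close>. A set of simple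
  roots \<open>e\<^sub>i - e\<^bsub>i+1\<^esub>\<close> is a set \<open>S\<close> of indices \<open>i\<close>; joining \<open>i\<close> to \<open>i + 1\<close> for \<open>i \<in> S\<close> cuts \<open>{1..N}\<close> into blocks
  of consecutive numbers, \<open>W\<^sub>J\<close> is the Young subgroup of permutations that preserve every block, and
  \<open>X\<^sub>J\<close> consists of the permutations that increase on every block. Two ideas carry this part: a permutation
  \<open>p\<close> of maximal weight \<open>\<Sum> i p(i)\<close> in a double coset is distinguished
  (\<open>ex_ascending_and_inv_ascending\<close>), and a function that increases on blocks is determined by
  the values it takes on each block (\<open>ascending_rearrangement_unique\<close>).
\<close>

section \<open>Blocks and Young subgroups\<close>

text \<open>The plain notation \<open>inv\<close> denotes inverses in an abstract group, hence a separate name for the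
  inverse of a function.\<close>

abbreviation perm_inv :: "('b \<Rightarrow> 'b) \<Rightarrow> 'b \<Rightarrow> 'b" where
  "perm_inv \<equiv> inv_into UNIV"

text \<open>The number of cuts below \<open>i\<close>, which serves as the index of the block containing \<open>i\<close>. This index is
  defined and monotone on all of \<open>nat\<close>, and it changes from \<open>i\<close> to \<open>i + 1\<close> exactly if \<open>i\<close> is not in \<open>S\<close>.\<close>

definition block :: "nat set \<Rightarrow> nat \<Rightarrow> nat" where
  "block S i = card ({..<i} - S)"

text \<open>The Young subgroup of the block decomposition, the permutation form of the parabolic subgroup \<open>W\<^sub>J\<close>.\<close>

definition young :: "nat \<Rightarrow> nat set \<Rightarrow> (nat \<Rightarrow> nat) set" where
  "young N S = {p. p permutes {1..N} \<and> (\<forall>i. block S (p i) = block S i)}"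

text \<open>On injective functions this is strict increase along \<open>S\<close>. The weak inequality allows the same notion
  for block indices, which take equal values.\<close>

definition ascending :: "nat set \<Rightarrow> (nat \<Rightarrow> 'b::linorder) \<Rightarrow> bool" where
  "ascending S f \<longleftrightarrow> (\<forall>i\<in>S. f i \<le> f (Suc i))"

lemma block_Suc: "block S (Suc i) = (if i \<in> S then block S i else Suc (block S i))"
proof -
  have "{..<Suc i} - S = (if i \<in> S then {..<i} - S else insert i ({..<i} - S))"
    by (auto simp: less_Suc_eq)
  then show ?thesis by (simp add: block_def)
qed

lemma block_mono: "i \<le> k \<Longrightarrow> block S i \<le> block S k"
  unfolding block_def by (rule card_mono) auto

lemma block_eq_imp_mem:
  assumes "block S i = block S k" "i \<le> m" "m < k"
  shows "m \<in> S" and "block S m = block S i"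
proof -
  have "block S i \<le> block S m" "block S m \<le> block S (Suc m)" "block S (Suc m) \<le> block S k"
    by (rule block_mono; use assms in simp)+
  then have "block S (Suc m) = block S m" "block S m = block S i"
    using assms(1) by linarith+
  then show "m \<in> S" "block S m = block S i"
    by (auto simp: block_Suc split: if_splits)
qed

text \<open>The blocks are the classes of the equivalence relation generated by \<open>i \<sim> i + 1\<close> for \<open>i \<in> S\<close>. This is
  the universal property of that relation.\<close>

lemma block_const:
  assumes "\<And>i. i \<in> S \<Longrightarrow> f (Suc i) = f i" "block S i = block S k"
  shows "f i = f k"
proof -
  have *: "f i = f k" if "i \<le> k" "block S i = block S k" for i k
    using that
  proof (induction rule: dec_induct)
    case (step m)
    then show ?case
      using block_eq_imp_mem[of S i "Suc m" m] assms(1) by simp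
  qed simp
  show ?thesis
  proof (cases "i \<le> k")
    case True
    then show ?thesis using * assms(2) by blast
  next
    case False
    then show ?thesis using *[of k i] assms(2) by simp
  qed
qed

lemma ascending_on_block:
  assumes "ascending S f" "block S i = block S k" "i \<le> k"
  shows "f i \<le> f k"
  using assms(3,2)
proof (induction rule: dec_induct)
  case (step m)
  have "m \<in> S" "block S m = block S i"
    using block_eq_imp_mem[OF step.prems step.hyps(1)] by auto
  then show ?case
    using assms(1) step.IH unfolding ascending_def by fastforce
qed simp

lemma young_permutes: "p \<in> young N S \<Longrightarrow> p permutes {1..N}"
  by (simp add: young_def)

lemma young_block: "p \<in> young N S \<Longrightarrow> block S (p i) = block S i"
  by (simp add: young_def)

lemma young_id: "id \<in> young N S"
  by (simp add: young_def permutes_id)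

lemma young_comp: "p \<in> young N S \<Longrightarrow> q \<in> young N S \<Longrightarrow> p \<circ> q \<in> young N S"
  by (auto simp: young_def intro: permutes_compose)

lemma young_inv: "p \<in> young N S \<Longrightarrow> perm_inv p \<in> young N S"
  unfolding young_def by (auto simp: permutes_inv) (metis permutes_inverses(1))

lemma young_transpose:
  assumes "i \<in> S" "S \<subseteq> {1..<N}"
  shows "transpose i (Suc i) \<in> young N S"
  using assms by (auto simp: young_def block_Suc transpose_def intro!: permutes_swap_id)

lemma young_full:
  assumes "p permutes {1..N}"
  shows "p \<in> young N {1..<N}"
proof -
  have same: "block {1..<N} i = block {1..<N} 1" if "i \<in> {1..N}" for i
  proof -
    have "{..<i} - {1..<N} = {..<1} - {1..<N}" using that by auto
    then show ?thesis by (simp add: block_def)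
  qed
  have "block {1..<N} (p i) = block {1..<N} i" for i
    using same[of i] same[of "p i"] permutes_in_image[OF assms, of i] permutes_not_in[OF assms, of i]
    by (cases "i \<in> {1..N}") auto
  then show ?thesis using assms by (simp add: young_def)
qed

text \<open>A weakly increasing sequence on a block is the sorted list of its values, so rearranging it within the
  block and obtaining an increasing sequence again gives the same sequence. This lemma is the source of all uniqueness
  statements on distinguished representatives. If \<open>f (p i)\<close> exceeded \<open>f i\<close>, the positions in the block where
  \<open>f\<close> is at least \<open>f (p i)\<close> would all lie to the right of \<open>i\<close>, while the positions where \<open>f \<circ> p\<close> is at
  least that large include \<open>i\<close> and everything to its right; but \<open>p\<close> maps the
  latter set bijectively to the former, so they cannot differ in size.\<close>

lemma ascending_rearrangement_unique:
  fixes f :: "nat \<Rightarrow> 'b::linorder"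
  assumes p: "p \<in> young N S" and f: "ascending S f" "ascending S (\<lambda>i. f (p i))"
  shows "f (p i) = f i"
proof -
  have le: "g (q i) \<le> g i"
    if q: "q \<in> young N S" and g: "ascending S g" "ascending S (\<lambda>i. g (q i))"
    for q i and g :: "nat \<Rightarrow> 'b"
  proof (rule ccontr)
    assume "\<not> g (q i) \<le> g i"
    then have less: "g i < g (q i)" by simp
    define B where "B = {k \<in> {1..N}. block S k = block S i}"
    define X where "X = {k \<in> B. g (q i) \<le> g (q k)}"
    define Y where "Y = {k \<in> B. g (q i) \<le> g k}"
    have qp: "q permutes {1..N}" using q by (rule young_permutes)
    have i: "i \<in> {1..N}"
      using less permutes_not_in[OF qp, of i] by fastforce
    have "q ` X = Y"
    proof
      show "q ` X \<subseteq> Y"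
        using permutes_in_image[OF qp] young_block[OF q] by (auto simp: X_def Y_def B_def)
      show "Y \<subseteq> q ` X"
      proof
        fix y assume "y \<in> Y"
        then have "perm_inv q y \<in> X" "y = q (perm_inv q y)"
          using permutes_in_image[OF permutes_inv[OF qp], of y] permutes_inverses(1)[OF qp, of y]
            young_block[OF q, of "perm_inv q y"]
          by (auto simp: X_def Y_def B_def)
        then show "y \<in> q ` X" by blast
      qed
    qed
    then have "card Y = card X"
      using card_image[OF inj_on_subset[OF permutes_inj[OF qp]], of X] by simp
    moreover have "Y \<subset> X"
    proof
      show "Y \<subseteq> X"
      proof
        fix k assume k: "k \<in> Y"
        have "\<not> k \<le> i"
        proof
          assume "k \<le> i"
          then have "g k \<le> g i"
            using ascending_on_block[OF g(1), of k i] k by (simp add: Y_def B_def)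
          then show False using less k by (auto simp: Y_def)
        qed
        then have "g (q i) \<le> g (q k)"
          using ascending_on_block[OF g(2), of i k] k by (simp add: Y_def B_def)
        then show "k \<in> X" using k by (auto simp: X_def Y_def)
      qed
      have "i \<in> X" "i \<notin> Y"
        using less i by (auto simp: X_def Y_def B_def)
      then show "Y \<noteq> X" by blast
    qed
    moreover have "finite X" by (simp add: X_def B_def)
    ultimately show False using psubset_card_mono[of X Y] by simp
  qed
  have "f (p i) \<le> f i" using le p f by blast
  \<comment> \<open>The reverse inequality is the same claim for \<open>f \<circ> p\<close> and the inverse of \<open>p\<close>.\<close>
  moreover have "f (p (perm_inv p i)) \<le> f (p i)"
    using le[OF young_inv[OF p] f(2), of i] f(1) permutes_inverses(1)[OF young_permutes[OF p]]
    by simp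
  ultimately show ?thesis
    using permutes_inverses(1)[OF young_permutes[OF p]] by simp
qed

section \<open>Distinguished double coset representatives\<close>

text \<open>The effect of an adjacent transposition on the weight \<open>\<Sum> j f(j)\<close>.\<close>

lemma sum_transpose_adjacent:
  fixes f :: "nat \<Rightarrow> int"
  assumes "i \<in> {1..<N}"
  shows "(\<Sum>j\<in>{1..N}. int (transpose i (Suc i) j) * f j) = (\<Sum>j\<in>{1..N}. int j * f j) + f i - f (Suc i)"
proof -
  have "(\<Sum>j\<in>{1..N}. int (transpose i (Suc i) j) * f j) - (\<Sum>j\<in>{1..N}. int j * f j)
    = (\<Sum>j\<in>{1..N}. (if j = i then f i else 0) - (if j = Suc i then f (Suc i) else 0))"
    unfolding sum_subtractf[symmetric]
    by (rule sum.cong) (auto simp: transpose_def algebra_simps)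
  also have "\<dots> = f i - f (Suc i)"
    using assms by (simp add: sum_subtractf)
  finally show ?thesis by simp
qed

text \<open>Choose \<open>p\<close> in \<open>A\<close> with maximal weight \<open>\<Sum> j p(j)\<close>. If \<open>p\<close> had a descent at \<open>i \<in> S\<close>, then \<open>p\<close> composed with the transposition of \<open>i\<close> and \<open>i + 1\<close> would have
  larger weight. The weight of \<open>p\<close> equals that of its inverse, so the same argument applies on the left.\<close>

lemma ex_ascending_and_inv_ascending:
  assumes A: "A \<noteq> {}" "\<And>p. p \<in> A \<Longrightarrow> p permutes {1..N}"
    and S: "S \<subseteq> {1..<N}" "\<And>p i. p \<in> A \<Longrightarrow> i \<in> S \<Longrightarrow> p \<circ> transpose i (Suc i) \<in> A"
    and T: "T \<subseteq> {1..<N}" "\<And>p i. p \<in> A \<Longrightarrow> i \<in> T \<Longrightarrow> transpose i (Suc i) \<circ> p \<in> A"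
  shows "\<exists>p\<in>A. ascending S p \<and> ascending T (perm_inv p)"
proof -
  define P where "P p = (\<Sum>j\<in>{1..N}. int j * int (p j))" for p :: "nat \<Rightarrow> nat"
  have "finite A"
    by (rule finite_subset[OF _ finite_permutations[of "{1..N}"]]) (use A in auto)
  then have "Max (P ` A) \<in> P ` A" and max: "\<And>q. q \<in> A \<Longrightarrow> P q \<le> Max (P ` A)"
    using A(1) by auto
  then obtain p where p: "p \<in> A" "\<And>q. q \<in> A \<Longrightarrow> P q \<le> P p" by auto
  have pp: "p permutes {1..N}" using A p by blast
  have "p i \<le> p (Suc i)" if "i \<in> S" for i
  proof -
    let ?t = "transpose i (Suc i)"
    have i: "i \<in> {1..<N}" using that S by blast
    then have "?t permutes {1..N}" by (auto intro!: permutes_swap_id)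
    then have "P (p \<circ> ?t) = (\<Sum>j\<in>{1..N}. int (?t j) * int (p j))"
      unfolding P_def
      by (subst sum.permute[of ?t]) (simp_all add: o_def)
    also have "\<dots> = P p + int (p i) - int (p (Suc i))"
      unfolding P_def by (rule sum_transpose_adjacent[OF i])
    finally show ?thesis using p(2)[OF S(2)[OF p(1) that]] by simp
  qed
  moreover have "perm_inv p i \<le> perm_inv p (Suc i)" if "i \<in> T" for i
  proof -
    let ?t = "transpose i (Suc i)"
    have i: "i \<in> {1..<N}" using that T by blast
    have "P (?t \<circ> p) = (\<Sum>j\<in>{1..N}. int (?t j) * int (perm_inv p j))"
      unfolding P_def
      by (subst sum.permute[OF permutes_inv[OF pp]])
        (simp add: o_def permutes_inverses(1)[OF pp] mult.commute)
    also have "\<dots> = (\<Sum>j\<in>{1..N}. int j * int (perm_inv p j)) + int (perm_inv p i) - int (perm_inv p (Suc i))"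
      by (rule sum_transpose_adjacent[OF i])
    also have "(\<Sum>j\<in>{1..N}. int j * int (perm_inv p j)) = P p"
      unfolding P_def
      by (subst sum.permute[OF pp])
        (simp add: o_def permutes_inverses(2)[OF pp] mult.commute)
    finally show ?thesis using p(2)[OF T(2)[OF p(1) that]] by linarith
  qed
  ultimately show ?thesis using p(1) by (auto simp: ascending_def)
qed

text \<open>A Young subgroup is generated by its adjacent transpositions. In the coset of \<open>p\<close> under left
  multiplication by those transpositions there is an element whose inverse is ascending; being in the
  Young subgroup, its inverse agrees with the identity by uniqueness of increasing rearrangements.\<close>

lemma young_induct:
  assumes p: "p \<in> young N S" and S: "S \<subseteq> {1..<N}"
    and id: "id \<in> A" and step: "\<And>q i. q \<in> A \<Longrightarrow> i \<in> S \<Longrightarrow> transpose i (Suc i) \<circ> q \<in> A"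
  shows "p \<in> A"
proof -
  \<comment> \<open>\<open>B\<close> contains \<open>p\<close> and is stable under the transpositions, as these are involutions.\<close>
  define B where "B = {q \<in> young N S. q \<in> A \<longrightarrow> p \<in> A}"
  have "\<exists>q\<in>B. ascending {} q \<and> ascending S (perm_inv q)"
  proof (rule ex_ascending_and_inv_ascending)
    show "B \<noteq> {}" using p by (auto simp: B_def)
    show "transpose i (Suc i) \<circ> q \<in> B" if q: "q \<in> B" and i: "i \<in> S" for q i
    proof -
      have "p \<in> A" if "transpose i (Suc i) \<circ> q \<in> A"
        using step[OF that i] q by (simp add: B_def o_assoc)
      then show ?thesis
        using q young_comp[OF young_transpose[OF i S]] by (auto simp: B_def)
    qed
  qed (use S young_permutes in \<open>auto simp: B_def\<close>)
  then obtain q where q: "q \<in> B" "ascending S (perm_inv q)" by blast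
  have qy: "q \<in> young N S" using q(1) by (simp add: B_def)
  have "perm_inv q i = i" for i
    using ascending_rearrangement_unique[OF young_inv[OF qy], of "\<lambda>i. i" i] q(2)
    by (simp add: ascending_def)
  then have "q = id"
    using permutes_inverses(1)[OF young_permutes[OF qy]] by (metis eq_id_iff)
  then show ?thesis using q(1) id by (simp add: B_def)
qed

lemma double_coset_rep_exists:
  assumes g: "g permutes {1..N}" and S: "S \<subseteq> {1..<N}" and T: "T \<subseteq> {1..<N}"
  shows "\<exists>u\<in>young N T. \<exists>v\<in>young N S. \<exists>d. d permutes {1..N} \<and>
    ascending S d \<and> ascending T (perm_inv d) \<and> g = u \<circ> d \<circ> v"
proof -
  define A where "A = {u \<circ> g \<circ> v | u v. u \<in> young N T \<and> v \<in> young N S}"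
  have "\<exists>d\<in>A. ascending S d \<and> ascending T (perm_inv d)"
  proof (rule ex_ascending_and_inv_ascending[where N = N])
    show "A \<noteq> {}" unfolding A_def using young_id by blast
    show "p permutes {1..N}" if "p \<in> A" for p
      using that g by (auto simp: A_def young_def intro!: permutes_compose)
    show "p \<circ> transpose i (Suc i) \<in> A" if p: "p \<in> A" and i: "i \<in> S" for p i
    proof -
      obtain u v where "p = u \<circ> g \<circ> v" and u: "u \<in> young N T" and v: "v \<in> young N S"
        using p by (auto simp: A_def)
      then have "p \<circ> transpose i (Suc i) = u \<circ> g \<circ> (v \<circ> transpose i (Suc i))"
        by (simp add: o_assoc)
      then show ?thesis
        using u young_comp[OF v young_transpose[OF i S]] unfolding A_def by blast
    qed
    show "transpose i (Suc i) \<circ> p \<in> A" if p: "p \<in> A" and i: "i \<in> T" for p i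
    proof -
      obtain u v where "p = u \<circ> g \<circ> v" and u: "u \<in> young N T" and v: "v \<in> young N S"
        using p by (auto simp: A_def)
      then have "transpose i (Suc i) \<circ> p = (transpose i (Suc i) \<circ> u) \<circ> g \<circ> v"
        by (simp add: o_assoc)
      then show ?thesis
        using v young_comp[OF young_transpose[OF i T] u] unfolding A_def by blast
    qed
  qed (use S T in auto)
  then obtain d u v where d: "ascending S d" "ascending T (perm_inv d)" "d = u \<circ> g \<circ> v"
    and u: "u \<in> young N T" and v: "v \<in> young N S"
    by (auto simp: A_def)
  have "g = perm_inv u \<circ> d \<circ> perm_inv v"
    using permutes_inverses[OF young_permutes[OF u]] permutes_inverses[OF young_permutes[OF v]]
    by (simp add: d(3) fun_eq_iff)
  moreover have "d permutes {1..N}"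
    using d(3) u v g by (auto simp: young_def intro!: permutes_compose)
  ultimately show ?thesis
    using d young_inv[OF u] young_inv[OF v] by blast
qed

text \<open>Along a block of \<open>S\<close>, the block indices of \<open>d\<close> and of \<open>d'\<close> under \<open>T\<close> are increasing rearrangements of each other,
  hence equal. So \<open>d'\<close> differs from \<open>d\<close> only within the blocks of \<open>T\<close>, where the inverses of both are increasing
  and the same argument shows them to be equal.\<close>

lemma double_coset_rep_unique:
  assumes u: "u \<in> young N T" and v: "v \<in> young N S" and eq: "d' = u \<circ> d \<circ> v"
    and d: "d permutes {1..N}" "ascending S d" "ascending T (perm_inv d)"
    and d': "d' permutes {1..N}" "ascending S d'" "ascending T (perm_inv d')"
  shows "d' = d"
proof -
  have same: "block T (d' i) = block T (d i)" for i
  proof -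
    have shift: "block T (d' k) = block T (d (v k))" for k
      using young_block[OF u] by (simp add: eq)
    have "block T (d (v i)) = block T (d i)"
    proof (rule ascending_rearrangement_unique[OF v, of "\<lambda>i. block T (d i)"])
      show "ascending S (\<lambda>i. block T (d i))" "ascending S (\<lambda>i. block T (d (v i)))"
        using d(2) d'(2) unfolding ascending_def shift[symmetric] by (auto intro: block_mono)
    qed
    then show ?thesis by (simp add: shift)
  qed
  \<comment> \<open>\<open>w\<close> turns the inverse of \<open>d\<close> into that of \<open>d'\<close>, and both are ascending on \<open>T\<close>.\<close>
  define w where "w = d \<circ> perm_inv d'"
  have w: "w \<in> young N T"
    unfolding young_def w_def
    using same[symmetric] permutes_inverses(1)[OF d'(1)] d(1) d'(1)
    by (auto intro: permutes_compose permutes_inv)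
  have inv_w: "perm_inv d (w i) = perm_inv d' i" for i
    using permutes_inverses(2)[OF d(1)] by (simp add: w_def)
  have "perm_inv d' i = perm_inv d i" for i
    using ascending_rearrangement_unique[OF w d(3), of i] d'(3) by (simp add: inv_w)
  then have "perm_inv d' = perm_inv d" by blast
  then show ?thesis
    using permutes_inv_inv[OF d(1)] permutes_inv_inv[OF d'(1)] by metis
qed

text \<open>The combinatorial core of the statement that \<open>W\<^sub>K \<inter> d\<^sup>-\<^sup>1 W\<^sub>J d\<close> is parabolic. For \<open>i\<close> and \<open>k\<close> in a common block
  of \<open>S\<close> with images in a common block of \<open>T\<close>, monotonicity of \<open>d\<close> keeps the images of all
  intermediate points in that block of \<open>T\<close>, and monotonicity of the inverse leaves no gap between consecutive
  images. Hence \<open>d\<close> acts as a shift from \<open>i\<close> to \<open>k\<close>.\<close>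

lemma block_inter_double_coset_rep:
  assumes d: "d permutes {1..N}" "ascending S d" "ascending T (perm_inv d)"
  defines "L \<equiv> {i \<in> S. d i \<in> T \<and> d (Suc i) = Suc (d i)}"
  shows "block L i = block L k \<longleftrightarrow> block S i = block S k \<and> block T (d i) = block T (d k)"
proof -
  have fwd: "block S i = block S k \<and> block T (d i) = block T (d k)" if "block L i = block L k"
    using block_const[of L "block S" i k] block_const[of L "\<lambda>i. block T (d i)" i k] that
    by (auto simp: L_def block_Suc)
  have bwd: "block L i = block L k"
    if "i \<le> k" and S_eq: "block S i = block S k" and T_eq: "block T (d i) = block T (d k)" for i k
  proof -
    have "m \<in> L" if m: "i \<le> m" "m < k" for m
    proof -
      have mS: "m \<in> S" "block S m = block S i"
        using block_eq_imp_mem[OF S_eq m] by auto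
      have "d i \<le> d m" "d (Suc m) \<le> d k"
        using m S_eq mS by (auto intro!: ascending_on_block[OF d(2)] simp: block_Suc)
      moreover have "d m < d (Suc m)"
        using d(2) mS(1) injD[OF permutes_inj[OF d(1)], of m "Suc m"]
        by (force simp: ascending_def)
      ultimately have mem: "x \<in> T" "block T x = block T (d m)" if "d m \<le> x" "x < d (Suc m)" for x
        using block_eq_imp_mem[OF T_eq, of x] block_eq_imp_mem[OF T_eq, of "d m"] that by auto
      \<comment> \<open>A value strictly between the two would have its position strictly between \<open>m\<close> and \<open>Suc m\<close>.\<close>
      have "d (Suc m) = Suc (d m)"
      proof (rule ccontr)
        assume "d (Suc m) \<noteq> Suc (d m)"
        then have x: "Suc (d m) < d (Suc m)" using \<open>d m < d (Suc m)\<close> by simp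
        have "block T (Suc (d m)) = block T (d m)"
          using mem(2)[of "Suc (d m)"] x by simp
        moreover have "block T (Suc (d m)) = block T (d (Suc m))"
        proof -
          have "block T (d m) = block T (d (Suc m))"
            using \<open>d i \<le> d m\<close> \<open>d m < d (Suc m)\<close> \<open>d (Suc m) \<le> d k\<close> T_eq
              block_mono[of "d i" "d m" T] block_mono[of "d m" "d (Suc m)" T]
              block_mono[of "d (Suc m)" "d k" T] by linarith
          then show ?thesis using calculation by simp
        qed
        ultimately have "perm_inv d (d m) \<le> perm_inv d (Suc (d m))" "perm_inv d (Suc (d m)) \<le> perm_inv d (d (Suc m))"
          using x by (auto intro!: ascending_on_block[OF d(3)])
        then have "perm_inv d (Suc (d m)) = m \<or> perm_inv d (Suc (d m)) = Suc m"
          by (auto simp: permutes_inverses(2)[OF d(1)])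
        then have "Suc (d m) = d m \<or> Suc (d m) = d (Suc m)"
          by (metis permutes_inverses(1)[OF d(1)])
        then show False using x by simp
      qed
      then show ?thesis using mS mem[of "d m"] by (simp add: L_def)
    qed
    then have "{i..<k} \<subseteq> L" by auto
    then have "x < i \<or> x \<in> L" if "x < k" for x
      using that by (cases "x < i") auto
    then have "{..<k} - L = {..<i} - L"
      using \<open>i \<le> k\<close> by auto
    then show ?thesis by (simp add: block_def)
  qed
  show ?thesis
    using fwd bwd[of i k] bwd[of k i] by (metis nat_le_linear)
qed

section \<open>Coxeter elements and conjugation of Young subgroups\<close>

text \<open>The Coxeter element is the product of the adjacent transpositions in \<open>S\<close>, which permutes each block
  cyclically. The property stated is that functions constant on its cycles are constant on the blocks. If \<open>m\<close> is
  larger than all of \<open>S\<close>, the element for \<open>S\<close> fixes \<open>m + 1\<close>; this lets the property pass to the product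
  with the transposition of \<open>m\<close> and \<open>m + 1\<close>.\<close>

lemma ex_coxeter_element:
  assumes "S \<subseteq> {1..<N}"
  shows "\<exists>c\<in>young N S. \<forall>f :: nat \<Rightarrow> 'b. (\<forall>j. f (c j) = f j) \<longrightarrow> (\<forall>i\<in>S. f (Suc i) = f i)"
proof -
  have "finite S" using assms finite_subset by blast
  then show ?thesis using assms
  proof (induction S arbitrary: N rule: finite_linorder_max_induct)
    case empty
    then show ?case using young_id by blast
  next
    case (insert m S)
    let ?t = "transpose m (Suc m)"
    from insert have "S \<subseteq> {1..<m}" by auto
    then obtain c where c: "c \<in> young m S"
      and cf: "\<And>f :: nat \<Rightarrow> 'b. (\<forall>j. f (c j) = f j) \<Longrightarrow> \<forall>i\<in>S. f (Suc i) = f i"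
      using insert.IH[of m] by blast
    have cS: "c permutes {1..m}" using c by (rule young_permutes)
    have mN: "m \<in> {1..<N}" using insert by simp
    have cN: "c permutes {1..N}" by (rule permutes_subset[OF cS]) (use mN in auto)
    have cfix: "c (Suc m) = Suc m" using permutes_not_in[OF cS] by simp
    have t: "?t \<in> young N (insert m S)"
      by (rule young_transpose) (use insert in auto)
    have "block (insert m S) (c i) = block (insert m S) i" for i
      using block_const[of S "block (insert m S)" "c i" i] young_block[OF c, of i]
      by (simp add: block_Suc)
    then have "c \<in> young N (insert m S)" using cN by (simp add: young_def)
    then have "?t \<circ> c \<in> young N (insert m S)" by (rule young_comp[OF t])
    moreover have "\<forall>i\<in>insert m S. f (Suc i) = f i"
      if f: "\<forall>j. f ((?t \<circ> c) j) = f j" for f :: "nat \<Rightarrow> 'b"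
    proof -
      have m: "f m = f (Suc m)"
        using f[rule_format, of "Suc m"] cfix by simp
      have "f (?t x) = f x" for x
        using m by (auto simp: transpose_def)
      then have "\<forall>j. f (c j) = f j" using f by simp
      then show ?thesis using cf m by auto
    qed
    ultimately show ?case by blast
  qed
qed

lemma young_conjugate:
  assumes p: "p permutes {1..N}" and ST: "\<And>i. i \<in> S \<Longrightarrow> p i \<in> T \<and> p (Suc i) = Suc (p i)"
    and q: "q \<in> young N S"
  shows "p \<circ> q \<circ> perm_inv p \<in> young N T"
proof -
  have "block T (p (q k)) = block T (p k)" for k
    using block_const[of S "\<lambda>i. block T (p i)" "q k" k] ST young_block[OF q]
    by (simp add: block_Suc)
  then have "block T ((p \<circ> q \<circ> perm_inv p) i) = block T i" for i
    using permutes_inverses(1)[OF p] by simp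
  then show ?thesis
    using p young_permutes[OF q] by (auto simp: young_def intro!: permutes_compose permutes_inv)
qed

text \<open>\<open>W\<^sub>K \<inter> d\<^sup>-\<^sup>1 W\<^sub>J d = W\<^sub>L\<close> in terms of permutations.\<close>

lemma young_inter_conjugate:
  assumes d: "d permutes {1..N}" "ascending S d" "ascending T (perm_inv d)"
    and q: "q permutes {1..N}"
  shows "q \<in> young N S \<and> d \<circ> q \<circ> perm_inv d \<in> young N T \<longleftrightarrow>
    q \<in> young N {i \<in> S. d i \<in> T \<and> d (Suc i) = Suc (d i)}"
proof -
  have "(\<forall>i. block T ((d \<circ> q \<circ> perm_inv d) i) = block T i) \<longleftrightarrow>
      (\<forall>i. block T (d (q i)) = block T (d i))"
    using permutes_inverses[OF d(1)] by (metis comp_apply)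
  moreover have "d \<circ> q \<circ> perm_inv d permutes {1..N}"
    using d(1) q by (auto intro!: permutes_compose permutes_inv)
  ultimately show ?thesis
    using block_inter_double_coset_rep[OF d] q unfolding young_def by auto
qed

text \<open>If \<open>p\<close> maps every block of \<open>S\<close> into a block of \<open>T\<close>, so does every element of its double coset. For the
  distinguished one the intersection \<open>L\<close> of the preceding lemmas is then all of \<open>S\<close>, which says that it
  carries the simple roots of \<open>S\<close> to simple roots of \<open>T\<close>.\<close>

lemma ex_shift_if_blocks_map_into_blocks:
  assumes p: "p permutes {1..N}" and S: "S \<subseteq> {1..<N}" and T: "T \<subseteq> {1..<N}"
    and into: "\<And>i. i \<in> S \<Longrightarrow> block T (p (Suc i)) = block T (p i)"
  shows "\<exists>h. h permutes {1..N} \<and> (\<forall>i\<in>S. h i \<in> T \<and> h (Suc i) = Suc (h i))"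
proof -
  obtain u v h where u: "u \<in> young N T" and v: "v \<in> young N S"
    and h: "h permutes {1..N}" "ascending S h" "ascending T (perm_inv h)" and eq: "p = u \<circ> h \<circ> v"
    using double_coset_rep_exists[OF p S T] by blast
  have "block T (h k) = block T (p (perm_inv v k))" for k
    using young_block[OF u] permutes_inverses(1)[OF young_permutes[OF v]] by (simp add: eq)
  moreover have "block S (perm_inv v (Suc i)) = block S (perm_inv v i)" if "i \<in> S" for i
    using young_block[OF young_inv[OF v]] that by (simp add: block_Suc)
  ultimately have "block T (h (Suc i)) = block T (h i)" if "i \<in> S" for i
    using block_const[of S "\<lambda>i. block T (p i)", OF into] that by metis
  then have "i \<in> {i \<in> S. h i \<in> T \<and> h (Suc i) = Suc (h i)}" if "i \<in> S" for i
    using block_inter_double_coset_rep[OF h, of "Suc i" i] that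
    by (auto simp: block_Suc split: if_splits)
  then show ?thesis using h(1) by blast
qed

section \<open>Fixed cosets and Mackey's formula\<close>

text \<open>The fixed points of \<open>w\<close> on \<open>G/H\<close>; their number is the value at \<open>w\<close> of the permutation character.\<close>

definition fixed_lcosets :: "('a, 'b) monoid_scheme \<Rightarrow> 'a set \<Rightarrow> 'a \<Rightarrow> 'a set set" where
  "fixed_lcosets G H w = {C \<in> lcosets\<^bsub>G\<^esub> H. w <#\<^bsub>G\<^esub> C = C}"

context group
begin

lemma mem_l_coset_iff:
  assumes "subgroup H G" "x \<in> carrier G" "y \<in> carrier G"
  shows "y \<in> x <# H \<longleftrightarrow> inv x \<otimes> y \<in> H"
  using assms subgroup.lcos_module_imp[OF assms(1) is_group] subgroup.lcos_module_rev[OF assms(1) is_group]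
  by blast

lemma l_coset_eqI:
  assumes "subgroup H G" "x \<in> carrier G" "y \<in> x <# H"
  shows "x <# H = y <# H"
  using assms l_repr_independence by blast

lemma l_coset_mult_fixed_iff:
  assumes H: "subgroup H G" and x: "x \<in> carrier G" and w: "w \<in> carrier G"
  shows "w <# (x <# H) = x <# H \<longleftrightarrow> w \<otimes> x \<in> x <# H"
proof -
  have assoc: "w <# (x <# H) = (w \<otimes> x) <# H"
    using lcos_m_assoc[OF subgroup.subset[OF H] w x] .
  show ?thesis
    unfolding assoc using l_coset_eqI[OF H x] lcos_self[OF _ H, of "w \<otimes> x"] w x by auto
qed

lemma mem_fixed_lcosets_iff:
  assumes H: "subgroup H G" and w: "w \<in> carrier G"
  shows "C \<in> fixed_lcosets G H w \<longleftrightarrow> (\<exists>x\<in>carrier G. C = x <# H \<and> w \<otimes> x \<in> C)"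
  unfolding fixed_lcosets_def LCOSETS_def using l_coset_mult_fixed_iff[OF H _ w] by auto

lemma fixed_lcosets_eqI:
  assumes H: "subgroup H G" and w: "w \<in> carrier G"
    and A: "A \<in> fixed_lcosets G H w" "x \<in> A"
  shows "x \<in> carrier G" "A = x <# H"
proof -
  obtain a where a: "a \<in> carrier G" "A = a <# H"
    using A(1) mem_fixed_lcosets_iff[OF H w] by blast
  then show "x \<in> carrier G" using A(2) l_coset_carrier[OF _ a(1) H] by blast
  show "A = x <# H" using l_coset_eqI[OF H a(1)] A(2) a(2) by blast
qed

lemma finite_fixed_lcosets:
  assumes "finite (carrier G)" "subgroup H G"
  shows "finite (fixed_lcosets G H w)"
  by (rule finite_subset[of _ "Pow (carrier G)"])
    (use assms lcosets_subset_PowG in \<open>auto simp: fixed_lcosets_def\<close>)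

text \<open>For a pair of cosets \<open>A\<close> of \<open>H\<close> and \<open>B\<close> of \<open>K\<close> whose relative position is the double coset of \<open>d\<close>, the set
  \<open>A d \<inter> B\<close> is a left coset of the stabiliser \<open>K \<inter> d\<^sup>-\<^sup>1 H d\<close>. This identifies the orbit of the
  pair with a coset space.\<close>

lemma r_coset_inter_l_coset:
  assumes H: "subgroup H G" and K: "subgroup K G" and d: "d \<in> carrier G" and g: "g \<in> carrier G"
  shows "(((g \<otimes> inv d) <# H) #> d) \<inter> (g <# K) = g <# {k \<in> K. d \<otimes> k \<otimes> inv d \<in> H}"
    (is "?A \<inter> ?B = ?C")
proof
  have Kc: "k \<in> carrier G" if "k \<in> K" for k using subgroup.mem_carrier[OF K that] .
  have Hc: "k \<in> carrier G" if "k \<in> H" for k using subgroup.mem_carrier[OF H that] .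
  show "?A \<inter> ?B \<subseteq> ?C"
  proof
    fix x assume "x \<in> ?A \<inter> ?B"
    then obtain h k where h: "h \<in> H" "x = g \<otimes> inv d \<otimes> h \<otimes> d" and k: "k \<in> K" "x = g \<otimes> k"
      unfolding l_coset_def r_coset_def by blast
    have "g \<otimes> k = g \<otimes> (inv d \<otimes> h \<otimes> d)"
      using h k d g Hc by (simp add: m_assoc)
    then have keq: "k = inv d \<otimes> h \<otimes> d"
      using h(1) k(1) d g Hc Kc by simp
    have "d \<otimes> k \<otimes> inv d = h"
      using h(1) d Hc unfolding keq by (simp add: m_assoc) (simp add: m_assoc[symmetric])
    then show "x \<in> ?C" using h k unfolding l_coset_def by blast
  qed
  show "?C \<subseteq> ?A \<inter> ?B"
  proof
    fix x assume "x \<in> ?C"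
    then obtain k where k: "k \<in> K" "d \<otimes> k \<otimes> inv d \<in> H" "x = g \<otimes> k"
      unfolding l_coset_def by blast
    have "x = g \<otimes> inv d \<otimes> (d \<otimes> k \<otimes> inv d) \<otimes> d"
      using k d g Kc by (simp add: m_assoc) (simp add: m_assoc[symmetric])
    then show "x \<in> ?A \<inter> ?B" using k unfolding l_coset_def r_coset_def by blast
  qed
qed

lemma subgroup_inter_conjugate:
  assumes H: "subgroup H G" and K: "subgroup K G" and d: "d \<in> carrier G"
  shows "subgroup {k \<in> K. d \<otimes> k \<otimes> inv d \<in> H} G"
proof (rule subgroupI)
  show "{k \<in> K. d \<otimes> k \<otimes> inv d \<in> H} \<subseteq> carrier G"
    using subgroup.subset[OF K] by auto
  show "{k \<in> K. d \<otimes> k \<otimes> inv d \<in> H} \<noteq> {}"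
    using subgroup.one_closed[OF K] subgroup.one_closed[OF H] d by (auto intro!: exI[of _ \<one>])
next
  fix a assume a: "a \<in> {k \<in> K. d \<otimes> k \<otimes> inv d \<in> H}"
  have "d \<otimes> inv a \<otimes> inv d = inv (d \<otimes> a \<otimes> inv d)"
    using a d subgroup.mem_carrier[OF K] by (simp add: inv_mult_group m_assoc)
  then show "inv a \<in> {k \<in> K. d \<otimes> k \<otimes> inv d \<in> H}"
    using a subgroup.m_inv_closed[OF H] subgroup.m_inv_closed[OF K] by auto
next
  fix a b assume a: "a \<in> {k \<in> K. d \<otimes> k \<otimes> inv d \<in> H}" and b: "b \<in> {k \<in> K. d \<otimes> k \<otimes> inv d \<in> H}"
  have "d \<otimes> (a \<otimes> b) \<otimes> inv d = (d \<otimes> a \<otimes> inv d) \<otimes> (d \<otimes> b \<otimes> inv d)"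
    using a b d subgroup.mem_carrier[OF K] by (simp add: m_assoc) (simp add: m_assoc[symmetric])
  then show "a \<otimes> b \<in> {k \<in> K. d \<otimes> k \<otimes> inv d \<in> H}"
    using a b subgroup.m_closed[OF H] subgroup.m_closed[OF K] by auto
qed

text \<open>The assignment \<open>(A, B) \<mapsto> A d \<inter> B\<close> is invertible, because any point \<open>g\<close> of the intersection recovers \<open>B = g K\<close>
  and \<open>A = g d\<^sup>-\<^sup>1 H\<close>. It commutes with left translation, so it matches fixed points with fixed points.\<close>

lemma bij_betw_fixed_lcosets_double_coset:
  assumes H: "subgroup H G" and K: "subgroup K G" and d: "d \<in> carrier G" and w: "w \<in> carrier G"
  shows "bij_betw (\<lambda>(A, B). (A #> d) \<inter> B)
    {(A, B). A \<in> fixed_lcosets G H w \<and> B \<in> fixed_lcosets G K w \<and> (A #> d) \<inter> B \<noteq> {}}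
    (fixed_lcosets G {k \<in> K. d \<otimes> k \<otimes> inv d \<in> H} w)"
    (is "bij_betw ?f ?R (fixed_lcosets G ?L w)")
proof -
  have L: "subgroup ?L G" by (rule subgroup_inter_conjugate[OF H K d])
  have Hc: "A \<subseteq> carrier G" if "A \<in> fixed_lcosets G H w" for A
    using fixed_lcosets_eqI(1)[OF H w that] by blast
  have rep: "g \<in> carrier G \<and> g \<otimes> inv d \<in> A \<and> g \<in> B \<and> A = (g \<otimes> inv d) <# H \<and> B = g <# K"
    if A: "A \<in> fixed_lcosets G H w" and B: "B \<in> fixed_lcosets G K w" and g: "g \<in> (A #> d) \<inter> B"
    for A B g
  proof -
    obtain a where a: "a \<in> A" "g = a \<otimes> d" using g unfolding r_coset_def by blast
    have ac: "a \<in> carrier G" using Hc A a by blast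
    have "g \<otimes> inv d = a" using ac d a by (simp add: m_assoc)
    then show ?thesis
      using a g fixed_lcosets_eqI[OF H w A, of a] fixed_lcosets_eqI[OF K w B, of g] by auto
  qed
  show ?thesis
    unfolding bij_betw_def
  proof (intro conjI equalityI subsetI)
    show "inj_on ?f ?R"
    proof (rule inj_onI)
      fix p q assume p: "p \<in> ?R" and q: "q \<in> ?R" and eq: "?f p = ?f q"
      obtain A B A' B' where pq: "p = (A, B)" "q = (A', B')" by fastforce
      obtain g where g: "g \<in> (A #> d) \<inter> B" "g \<in> (A' #> d) \<inter> B'"
        using p eq unfolding pq by auto
      show "p = q"
        using rep[OF _ _ g(1)] rep[OF _ _ g(2)] p q unfolding pq by auto
    qed
  next
    fix C assume "C \<in> ?f ` ?R"
    then obtain A B where A: "A \<in> fixed_lcosets G H w" and B: "B \<in> fixed_lcosets G K w"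
      and C: "C = (A #> d) \<inter> B" "C \<noteq> {}" by auto
    then obtain g where g: "g \<in> (A #> d) \<inter> B" by blast
    note r = rep[OF A B g]
    have eq: "C = g <# ?L"
      using r_coset_inter_l_coset[OF H K d, of g] r C(1) by auto
    have "w \<otimes> (g \<otimes> inv d) \<in> A" "w \<otimes> g \<in> B"
      using l_coset_mult_fixed_iff[OF H _ w, of "g \<otimes> inv d"] l_coset_mult_fixed_iff[OF K _ w, of g] A B r d
      by (auto simp: fixed_lcosets_def)
    moreover have "w \<otimes> g = (w \<otimes> (g \<otimes> inv d)) \<otimes> d"
      using w d r by (simp add: m_assoc)
    ultimately have "w \<otimes> g \<in> C" unfolding C(1) r_coset_def by blast
    then show "C \<in> fixed_lcosets G ?L w"
      using mem_fixed_lcosets_iff[OF L w] eq r by blast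
  next
    fix C assume "C \<in> fixed_lcosets G ?L w"
    then obtain g where g: "g \<in> carrier G" "C = g <# ?L" "w \<otimes> g \<in> C"
      using mem_fixed_lcosets_iff[OF L w] by blast
    let ?A = "(g \<otimes> inv d) <# H" and ?B = "g <# K"
    have C: "C = (?A #> d) \<inter> ?B"
      using r_coset_inter_l_coset[OF H K d g(1)] g(2) by simp
    obtain a where a: "a \<in> ?A" "w \<otimes> g = a \<otimes> d"
      using g(3) unfolding C r_coset_def by blast
    have "a \<in> carrier G" using l_coset_carrier[OF a(1) _ H] g d by simp
    then have "w \<otimes> (g \<otimes> inv d) = a"
      using a(2) w g d by (simp add: m_assoc[symmetric]) (simp add: m_assoc)
    then have "?A \<in> fixed_lcosets G H w"
      using mem_fixed_lcosets_iff[OF H w] a(1) g d by blast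
    moreover have "?B \<in> fixed_lcosets G K w"
      using mem_fixed_lcosets_iff[OF K w] g C by blast
    ultimately show "C \<in> ?f ` ?R"
      using g(3) unfolding C by (auto intro!: rev_image_eqI[of "(?A, ?B)"])
  qed
qed

text \<open>Mackey's formula for permutation characters: every pair of cosets has its relative position in exactly
  one of the double cosets, and the pairs with position \<open>d\<close> are counted by the preceding bijection.\<close>

lemma card_fixed_lcosets_mult:
  assumes fin: "finite (carrier G)" and H: "subgroup H G" and K: "subgroup K G" and w: "w \<in> carrier G"
    and D: "D \<subseteq> carrier G"
    and ex: "\<And>g. g \<in> carrier G \<Longrightarrow> \<exists>d\<in>D. \<exists>h\<in>H. \<exists>k\<in>K. g = h \<otimes> d \<otimes> k"
    and unique: "\<And>d d' h k. d \<in> D \<Longrightarrow> d' \<in> D \<Longrightarrow> h \<in> H \<Longrightarrow> k \<in> K \<Longrightarrow> d' = h \<otimes> d \<otimes> k \<Longrightarrow> d' = d"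
  shows "card (fixed_lcosets G H w) * card (fixed_lcosets G K w) =
    (\<Sum>d\<in>D. card (fixed_lcosets G {k \<in> K. d \<otimes> k \<otimes> inv d \<in> H} w))"
proof -
  let ?R = "\<lambda>d. {(A, B). A \<in> fixed_lcosets G H w \<and> B \<in> fixed_lcosets G K w \<and> (A #> d) \<inter> B \<noteq> {}}"
  have Kc: "k \<in> carrier G" if "k \<in> K" for k using subgroup.mem_carrier[OF K that] .
  have Hc: "k \<in> carrier G" if "k \<in> H" for k using subgroup.mem_carrier[OF H that] .
  have meets: "(((x <# H) #> d) \<inter> (y <# K) \<noteq> {}) \<longleftrightarrow> (\<exists>h\<in>H. \<exists>k\<in>K. inv x \<otimes> y = h \<otimes> d \<otimes> k)"
    if x: "x \<in> carrier G" and y: "y \<in> carrier G" and d: "d \<in> carrier G" for x y d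
  proof
    assume "((x <# H) #> d) \<inter> (y <# K) \<noteq> {}"
    then obtain h k where h: "h \<in> H" and k: "k \<in> K" and eq: "x \<otimes> h \<otimes> d = y \<otimes> k"
      unfolding l_coset_def r_coset_def by blast
    have "inv x \<otimes> y = inv x \<otimes> (y \<otimes> k) \<otimes> inv k"
      using x y k Kc by (simp add: m_assoc)
    also have "\<dots> = h \<otimes> d \<otimes> inv k"
      unfolding eq[symmetric] using x h d k Hc Kc by (simp add: m_assoc[symmetric])
    finally show "\<exists>h\<in>H. \<exists>k\<in>K. inv x \<otimes> y = h \<otimes> d \<otimes> k"
      using h subgroup.m_inv_closed[OF K k] by blast
  next
    assume "\<exists>h\<in>H. \<exists>k\<in>K. inv x \<otimes> y = h \<otimes> d \<otimes> k"
    then obtain h k where h: "h \<in> H" and k: "k \<in> K" and eq: "inv x \<otimes> y = h \<otimes> d \<otimes> k" by blast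
    have "y \<otimes> inv k = x \<otimes> (inv x \<otimes> y) \<otimes> inv k"
      using x y k Kc by (simp add: m_assoc[symmetric])
    also have "\<dots> = x \<otimes> h \<otimes> d"
      unfolding eq using x h d k Hc Kc by (simp add: m_assoc)
    finally show "((x <# H) #> d) \<inter> (y <# K) \<noteq> {}"
      using h subgroup.m_inv_closed[OF K k] unfolding l_coset_def r_coset_def by blast
  qed
  have reps: "\<exists>x\<in>carrier G. A = x <# H" if "A \<in> fixed_lcosets G H w" for A H
    using that by (auto simp: fixed_lcosets_def LCOSETS_def)
  have "fixed_lcosets G H w \<times> fixed_lcosets G K w = (\<Union>d\<in>D. ?R d)"
  proof
    show "fixed_lcosets G H w \<times> fixed_lcosets G K w \<subseteq> (\<Union>d\<in>D. ?R d)"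
    proof clarify
      fix A B assume A: "A \<in> fixed_lcosets G H w" and B: "B \<in> fixed_lcosets G K w"
      obtain x y where x: "x \<in> carrier G" "A = x <# H" and y: "y \<in> carrier G" "B = y <# K"
        using reps A B by metis
      obtain d h k where "d \<in> D" "h \<in> H" "k \<in> K" "inv x \<otimes> y = h \<otimes> d \<otimes> k"
        using ex[of "inv x \<otimes> y"] x y by auto
      then show "(A, B) \<in> (\<Union>d\<in>D. ?R d)"
        using meets[OF x(1) y(1), of d] A B D x y by blast
    qed
  qed auto
  then have "card (fixed_lcosets G H w) * card (fixed_lcosets G K w) = card (\<Union>d\<in>D. ?R d)"
    by (simp add: card_cartesian_product[symmetric])
  also have "\<dots> = (\<Sum>d\<in>D. card (?R d))"
  proof (rule card_UN_disjoint)
    show "finite D" using D fin finite_subset by blast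
    have "finite (fixed_lcosets G H w \<times> fixed_lcosets G K w)"
      using finite_fixed_lcosets[OF fin] H K by blast
    then show "\<forall>d\<in>D. finite (?R d)"
      by (auto intro: finite_subset[rotated])
    show "\<forall>d\<in>D. \<forall>d'\<in>D. d \<noteq> d' \<longrightarrow> ?R d \<inter> ?R d' = {}"
    proof (intro ballI impI, rule ccontr)
      fix d d' assume d: "d \<in> D" "d' \<in> D" "d \<noteq> d'" and "?R d \<inter> ?R d' \<noteq> {}"
      then obtain A B where A: "A \<in> fixed_lcosets G H w" and B: "B \<in> fixed_lcosets G K w"
        and AB: "(A #> d) \<inter> B \<noteq> {}" "(A #> d') \<inter> B \<noteq> {}" by auto
      obtain x y where x: "x \<in> carrier G" "A = x <# H" and y: "y \<in> carrier G" "B = y <# K"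
        using reps A B by metis
      have dc: "d \<in> carrier G" "d' \<in> carrier G" using d D by auto
      obtain h k h' k' where h: "h \<in> H" "h' \<in> H" and k: "k \<in> K" "k' \<in> K"
        and eq: "inv x \<otimes> y = h \<otimes> d \<otimes> k" "inv x \<otimes> y = h' \<otimes> d' \<otimes> k'"
        using AB meets[OF x(1) y(1)] dc unfolding x y by metis
      have "d' = inv h' \<otimes> (h' \<otimes> d' \<otimes> k') \<otimes> inv k'"
        using h k dc Hc Kc by (simp add: m_assoc) (simp add: m_assoc[symmetric])
      also have "\<dots> = (inv h' \<otimes> h) \<otimes> d \<otimes> (k \<otimes> inv k')"
        unfolding eq(2)[symmetric] eq(1) using h k dc Hc Kc by (simp add: m_assoc)
      finally have "d' = (inv h' \<otimes> h) \<otimes> d \<otimes> (k \<otimes> inv k')" .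
      moreover have "inv h' \<otimes> h \<in> H" "k \<otimes> inv k' \<in> K"
        using h k H K by (auto intro: subgroup.m_closed subgroup.m_inv_closed)
      ultimately have "d' = d" using unique[OF d(1,2)] by blast
      then show False using d(3) by simp
    qed
  qed
  also have "\<dots> = (\<Sum>d\<in>D. card (fixed_lcosets G {k \<in> K. d \<otimes> k \<otimes> inv d \<in> H} w))"
    using bij_betw_same_card[OF bij_betw_fixed_lcosets_double_coset[OF H K _ w]] D
    by (intro sum.cong) auto
  finally show ?thesis .
qed

text \<open>Right translation by \<open>g\<^sup>-\<^sup>1\<close> embeds the cosets of \<open>H\<close> into those of \<open>g H g\<^sup>-\<^sup>1\<close>, compatibly with left
  multiplication by \<open>w\<close>.\<close>

lemma card_fixed_lcosets_conjugate_le: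
  assumes fin: "finite (carrier G)" and H: "subgroup H G" and K: "subgroup K G"
    and w: "w \<in> carrier G" and g: "g \<in> carrier G"
    and conj: "\<And>x. x \<in> carrier G \<Longrightarrow> g \<otimes> x \<otimes> inv g \<in> K \<longleftrightarrow> x \<in> H"
  shows "card (fixed_lcosets G H w) \<le> card (fixed_lcosets G K w)"
proof (rule card_inj_on_le[where f = "\<lambda>C. C #> inv g"])
  have sub: "C \<subseteq> carrier G" if "C \<in> fixed_lcosets G H w" for C
    using fixed_lcosets_eqI(1)[OF H w that] by blast
  have undo: "(C #> inv g) #> g = C" if "C \<in> fixed_lcosets G H w" for C
    using sub[OF that] g by (simp add: coset_mult_assoc coset_mult_one)
  show "inj_on (\<lambda>C. C #> inv g) (fixed_lcosets G H w)"
    by (rule inj_on_inverseI[where g = "\<lambda>C. C #> g"]) (rule undo)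
  show "(\<lambda>C. C #> inv g) ` fixed_lcosets G H w \<subseteq> fixed_lcosets G K w"
  proof clarify
    fix C assume "C \<in> fixed_lcosets G H w"
    then obtain x where x: "x \<in> carrier G" "C = x <# H" "w \<otimes> x \<in> C"
      using mem_fixed_lcosets_iff[OF H w] by blast
    have iff: "c \<otimes> inv g \<in> (x \<otimes> inv g) <# K \<longleftrightarrow> c \<in> C" if c: "c \<in> carrier G" for c
    proof -
      have "inv (x \<otimes> inv g) \<otimes> (c \<otimes> inv g) = g \<otimes> (inv x \<otimes> c) \<otimes> inv g"
        using x(1) c g by (simp add: inv_mult_group m_assoc)
      then show ?thesis
        using mem_l_coset_iff[OF K, of "x \<otimes> inv g" "c \<otimes> inv g"] mem_l_coset_iff[OF H x(1) c]
          conj[of "inv x \<otimes> c"] x c g by simp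
    qed
    have "C #> inv g = (x \<otimes> inv g) <# K"
    proof
      show "C #> inv g \<subseteq> (x \<otimes> inv g) <# K"
        using iff l_coset_subset_G[OF subgroup.subset[OF H] x(1)] unfolding r_coset_def x(2) by auto
      show "(x \<otimes> inv g) <# K \<subseteq> C #> inv g"
      proof
        fix y assume y: "y \<in> (x \<otimes> inv g) <# K"
        then have yc: "y \<in> carrier G" using l_coset_carrier[OF y _ K] x(1) g by simp
        then have "y = y \<otimes> g \<otimes> inv g" using g by (simp add: m_assoc)
        then show "y \<in> C #> inv g"
          using iff[of "y \<otimes> g"] y yc g unfolding r_coset_def by auto
      qed
    qed
    moreover have "w \<otimes> (x \<otimes> inv g) \<in> C #> inv g"
      using x w g by (auto simp: r_coset_def m_assoc[symmetric])
    ultimately show "C #> inv g \<in> fixed_lcosets G K w"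
      using mem_fixed_lcosets_iff[OF K w] x(1) g by blast
  qed
  show "finite (fixed_lcosets G K w)" by (rule finite_fixed_lcosets[OF fin K])
qed

lemma card_fixed_lcosets_conjugate:
  assumes fin: "finite (carrier G)" and H: "subgroup H G" and K: "subgroup K G"
    and w: "w \<in> carrier G" and g: "g \<in> carrier G"
    and conj: "\<And>x. x \<in> carrier G \<Longrightarrow> g \<otimes> x \<otimes> inv g \<in> K \<longleftrightarrow> x \<in> H"
  shows "card (fixed_lcosets G H w) = card (fixed_lcosets G K w)"
proof (rule antisym)
  show "card (fixed_lcosets G H w) \<le> card (fixed_lcosets G K w)"
    by (rule card_fixed_lcosets_conjugate_le[OF fin H K w g conj])
  have "inv g \<otimes> x \<otimes> inv (inv g) \<in> H \<longleftrightarrow> x \<in> K" if x: "x \<in> carrier G" for x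
  proof -
    have "g \<otimes> (inv g \<otimes> x \<otimes> g) \<otimes> inv g = x"
      using g x by (simp add: m_assoc) (simp add: m_assoc[symmetric])
    then show ?thesis using conj[of "inv g \<otimes> x \<otimes> g"] g x by simp
  qed
  then show "card (fixed_lcosets G K w) \<le> card (fixed_lcosets G H w)"
    by (intro card_fixed_lcosets_conjugate_le[OF fin K H w, of "inv g"]) (use g in auto)
qed

end

section \<open>The descent algebra as an algebra of characters\<close>

lemma class_rep:
  assumes "c \<in> x_classes \<Phi> \<Delta>"
  shows "class_rep \<Phi> \<Delta> c \<subseteq> \<Delta>" "x_class \<Phi> \<Delta> (class_rep \<Phi> \<Delta> c) = c"
proof -
  have "\<exists>J. J \<subseteq> \<Delta> \<and> x_class \<Phi> \<Delta> J = c"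
    using assms by (auto simp: x_classes_def)
  then have "class_rep \<Phi> \<Delta> c \<subseteq> \<Delta> \<and> x_class \<Phi> \<Delta> (class_rep \<Phi> \<Delta> c) = c"
    unfolding class_rep_def by (rule someI_ex)
  then show "class_rep \<Phi> \<Delta> c \<subseteq> \<Delta>" "x_class \<Phi> \<Delta> (class_rep \<Phi> \<Delta> c) = c" by auto
qed

text \<open>What the Weyl group contributes to the isomorphism: a well-defined, multiplicative and injective assignment
  of characters to classes. Everything in this locale is linear algebra over these properties.\<close>

locale mackey_characters =
  fixes \<Phi> \<Delta> :: "'a::real_inner set"
  assumes finite_simple: "finite \<Delta>"
    and perm_char_cong: "\<lbrakk>J \<subseteq> \<Delta>; K \<subseteq> \<Delta>; x_class \<Phi> \<Delta> J = x_class \<Phi> \<Delta> K\<rbrakk>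
      \<Longrightarrow> perm_char \<Phi> J = perm_char \<Phi> K"
    and perm_char_independent:
      "\<lbrakk>\<And>w. (\<Sum>c\<in>x_classes \<Phi> \<Delta>. u c * perm_char \<Phi> (class_rep \<Phi> \<Delta> c) w) = 0; c \<in> x_classes \<Phi> \<Delta>\<rbrakk>
      \<Longrightarrow> u c = 0"
    and perm_char_mult: "\<lbrakk>J \<subseteq> \<Delta>; K \<subseteq> \<Delta>\<rbrakk> \<Longrightarrow> perm_char \<Phi> J w * perm_char \<Phi> K w =
      (\<Sum>L\<in>Pow K. of_nat (struct_const \<Phi> \<Delta> J K L) * perm_char \<Phi> L w)"
    and perm_char_top: "perm_char \<Phi> \<Delta> w = of_bool (w \<in> refl_group \<Phi>)"
begin

abbreviation "Cls \<equiv> x_classes \<Phi> \<Delta>"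
abbreviation "rep \<equiv> class_rep \<Phi> \<Delta>"
abbreviation "D \<equiv> new_descent_algebra \<Phi> \<Delta>"
abbreviation "P \<equiv> perm_char_algebra \<Phi> \<Delta>"

definition char_map :: "((('a \<Rightarrow> 'a) \<Rightarrow> rat) set \<Rightarrow> rat) \<Rightarrow> ('a \<Rightarrow> 'a) \<Rightarrow> rat" where
  "char_map u = (\<lambda>w. \<Sum>c\<in>Cls. u c * perm_char \<Phi> (rep c) w)"

lemma finite_classes: "finite Cls"
  using finite_simple by (simp add: x_classes_def)

lemma x_class_in_classes: "J \<subseteq> \<Delta> \<Longrightarrow> x_class \<Phi> \<Delta> J \<in> Cls"
  by (auto simp: x_classes_def)

lemma perm_char_class_rep: "J \<subseteq> \<Delta> \<Longrightarrow> perm_char \<Phi> (rep (x_class \<Phi> \<Delta> J)) = perm_char \<Phi> J"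
  using class_rep[OF x_class_in_classes] by (intro perm_char_cong) auto

lemma class_vec_carrier: "J \<subseteq> \<Delta> \<Longrightarrow> class_vec \<Phi> \<Delta> J \<in> carrier D"
  using x_class_in_classes by (auto simp: new_descent_algebra_def class_vec_def)

lemma class_prod_carrier: "K \<subseteq> \<Delta> \<Longrightarrow> class_prod \<Phi> \<Delta> J K \<in> carrier D"
  using class_vec_carrier
  by (auto simp: new_descent_algebra_def class_prod_def intro!: sum.neutral)

lemma mult_carrier: "u \<otimes>\<^bsub>D\<^esub> v \<in> carrier D"
proof -
  have "class_prod \<Phi> \<Delta> (rep c) (rep d) b = 0" if "d \<in> Cls" "b \<notin> Cls" for c d b
    using class_prod_carrier[OF class_rep(1)[OF that(1)]] that(2)
    by (simp add: new_descent_algebra_def)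
  then show ?thesis
    by (auto simp: new_descent_algebra_def intro!: sum.neutral)
qed

lemma char_map_sum:
  "char_map (\<lambda>c. \<Sum>i\<in>I. a i * f i c) = (\<lambda>w. \<Sum>i\<in>I. a i * char_map (f i) w)"
  unfolding char_map_def
  by (simp add: sum_distrib_left sum_distrib_right mult.assoc sum.swap[of _ Cls])

lemma char_map_add: "char_map (\<lambda>c. u c + v c) = (\<lambda>w. char_map u w + char_map v w)"
  by (simp add: char_map_def distrib_right sum.distrib)

lemma char_map_smult: "char_map (\<lambda>c. q * u c) = (\<lambda>w. q * char_map u w)"
  by (simp add: char_map_def sum_distrib_left mult.assoc)

lemma char_map_zero: "char_map (\<lambda>c. 0) = (\<lambda>w. 0)"
  by (simp add: char_map_def)

lemma char_map_class_vec:
  assumes "J \<subseteq> \<Delta>"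
  shows "char_map (class_vec \<Phi> \<Delta> J) = perm_char \<Phi> J"
proof
  fix w
  have "char_map (class_vec \<Phi> \<Delta> J) w =
      (\<Sum>c\<in>Cls. if c = x_class \<Phi> \<Delta> J then perm_char \<Phi> (rep (x_class \<Phi> \<Delta> J)) w else 0)"
    unfolding char_map_def class_vec_def by (rule sum.cong) auto
  then show "char_map (class_vec \<Phi> \<Delta> J) w = perm_char \<Phi> J w"
    using finite_classes x_class_in_classes[OF assms] by (simp add: perm_char_class_rep[OF assms])
qed

lemma char_map_class_prod:
  assumes "J \<subseteq> \<Delta>" "K \<subseteq> \<Delta>"
  shows "char_map (class_prod \<Phi> \<Delta> J K) = (\<lambda>w. perm_char \<Phi> J w * perm_char \<Phi> K w)"
proof -
  have "char_map (class_prod \<Phi> \<Delta> J K) =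
      (\<lambda>w. \<Sum>L\<in>Pow K. of_nat (struct_const \<Phi> \<Delta> J K L) * char_map (class_vec \<Phi> \<Delta> L) w)"
    unfolding class_prod_def by (rule char_map_sum)
  also have "\<dots> = (\<lambda>w. \<Sum>L\<in>Pow K. of_nat (struct_const \<Phi> \<Delta> J K L) * perm_char \<Phi> L w)"
    using assms(2) by (intro ext sum.cong) (auto simp: char_map_class_vec)
  finally show ?thesis
    using perm_char_mult[OF assms] by simp
qed

lemma char_map_mult: "char_map (u \<otimes>\<^bsub>D\<^esub> v) = (\<lambda>w. char_map u w * char_map v w)"
proof -
  have "char_map (u \<otimes>\<^bsub>D\<^esub> v) = char_map (\<lambda>b. \<Sum>p\<in>Cls \<times> Cls.
      (u (fst p) * v (snd p)) * class_prod \<Phi> \<Delta> (rep (fst p)) (rep (snd p)) b)"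
    by (simp add: new_descent_algebra_def sum.cartesian_product case_prod_beta)
  also have "\<dots> = (\<lambda>w. \<Sum>p\<in>Cls \<times> Cls. (u (fst p) * v (snd p)) *
      (perm_char \<Phi> (rep (fst p)) w * perm_char \<Phi> (rep (snd p)) w))"
    unfolding char_map_sum
    by (intro ext sum.cong) (auto simp: char_map_class_prod class_rep)
  also have "\<dots> = (\<lambda>w. char_map u w * char_map v w)"
    by (simp add: char_map_def sum_product sum.cartesian_product case_prod_beta mult_ac)
  finally show ?thesis .
qed

lemma char_map_inj: "inj_on char_map (carrier D)"
proof (rule inj_onI)
  fix u v assume u: "u \<in> carrier D" and v: "v \<in> carrier D" and eq: "char_map u = char_map v"
  show "u = v"
  proof
    fix c
    show "u c = v c"
    proof (cases "c \<in> Cls")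
      case True
      have "(\<Sum>c\<in>Cls. (u c - v c) * perm_char \<Phi> (rep c) w) = 0" for w
        using fun_cong[OF eq, of w]
        by (simp add: char_map_def left_diff_distrib sum_subtractf)
      then show ?thesis
        using perm_char_independent[of "\<lambda>c. u c - v c" c] True by simp
    next
      case False
      then show ?thesis using u v by (simp add: new_descent_algebra_def)
    qed
  qed
qed

text \<open>Stated for an arbitrary additively closed set of coefficients containing \<open>0\<close>, since it gives surjectivity over the
  rationals as well as the description of the integral lattice. Inclusion from left to right puts all of
  the coefficient of a class on its chosen representative; the converse adds up the coefficients within each class.\<close>

lemma char_map_image:
  assumes A: "0 \<in> A" "\<And>x y. x \<in> A \<Longrightarrow> y \<in> A \<Longrightarrow> x + y \<in> A"
  shows "char_map ` {u \<in> carrier D. \<forall>c. u c \<in> A} = perm_char_span A \<Phi> \<Delta>"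
proof (intro equalityI subsetI)
  fix f assume "f \<in> char_map ` {u \<in> carrier D. \<forall>c. u c \<in> A}"
  then obtain u where u: "\<forall>c. u c \<in> A" "f = char_map u" by blast
  define a where "a J = (if J \<in> rep ` Cls then u (x_class \<Phi> \<Delta> J) else 0)" for J
  have inj: "inj_on rep Cls"
    by (rule inj_on_inverseI) (rule class_rep(2))
  have "f w = (\<Sum>J\<in>Pow \<Delta>. a J * perm_char \<Phi> J w)" for w
  proof -
    have "(\<Sum>J\<in>Pow \<Delta>. a J * perm_char \<Phi> J w) = (\<Sum>J\<in>rep ` Cls. a J * perm_char \<Phi> J w)"
      using finite_simple class_rep(1) by (intro sum.mono_neutral_right) (auto simp: a_def)
    also have "\<dots> = f w"
      unfolding u(2) char_map_def sum.reindex[OF inj] o_def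
      by (rule sum.cong) (auto simp: a_def class_rep(2))
    finally show ?thesis by simp
  qed
  moreover have "\<forall>J. a J \<in> A" using u(1) A(1) by (simp add: a_def)
  ultimately show "f \<in> perm_char_span A \<Phi> \<Delta>"
    unfolding perm_char_span_def by (auto intro!: exI[of _ a])
next
  fix f assume "f \<in> perm_char_span A \<Phi> \<Delta>"
  then obtain a where a: "\<forall>J. a J \<in> A" "f = (\<lambda>w. \<Sum>J\<in>Pow \<Delta>. a J * perm_char \<Phi> J w)"
    unfolding perm_char_span_def by blast
  define u where "u = (\<lambda>c. \<Sum>J\<in>Pow \<Delta>. a J * class_vec \<Phi> \<Delta> J c)"
  have "char_map u = f"
    unfolding u_def char_map_sum a(2) by (intro ext sum.cong) (auto simp: char_map_class_vec)
  moreover have "u \<in> carrier D"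
    using class_vec_carrier by (auto simp: u_def new_descent_algebra_def intro!: sum.neutral)
  moreover have "u c \<in> A" for c
  proof -
    have "(\<Sum>J\<in>F. a J * class_vec \<Phi> \<Delta> J c) \<in> A" for F
    proof (induction F rule: infinite_finite_induct)
      case (insert J F)
      have "a J * class_vec \<Phi> \<Delta> J c \<in> A" using A(1) a(1) by (simp add: class_vec_def)
      then show ?case using insert A(2) by simp
    qed (use A(1) in auto)
    then show ?thesis by (simp add: u_def)
  qed
  ultimately show "f \<in> char_map ` {u \<in> carrier D. \<forall>c. u c \<in> A}" by blast
qed

lemma char_map_image_carrier: "char_map ` carrier D = carrier P"
  using char_map_image[of UNIV] by (simp add: perm_char_algebra_def)

lemma char_map_one: "char_map \<one>\<^bsub>D\<^esub> = \<one>\<^bsub>P\<^esub>"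
  using char_map_class_vec[of \<Delta>] perm_char_top
  by (auto simp: new_descent_algebra_def perm_char_algebra_def fun_eq_iff)

lemma one_mult_char_map: "of_bool (w \<in> refl_group \<Phi>) * char_map u w = char_map u w"
  by (simp add: char_map_def perm_char_def sum_distrib_left)

lemma cring_rat_ring: "cring rat_ring"
proof (intro cringI abelian_groupI comm_monoidI)
  show "\<exists>y\<in>carrier rat_ring. y \<oplus>\<^bsub>rat_ring\<^esub> x = \<zero>\<^bsub>rat_ring\<^esub>" for x
    by (auto simp: rat_ring_def intro: exI[of _ "- x"])
qed (auto simp: rat_ring_def algebra_simps)

lemma descent_ops:
  "u \<oplus>\<^bsub>D\<^esub> v = (\<lambda>c. u c + v c)" "q \<odot>\<^bsub>D\<^esub> u = (\<lambda>c. q * u c)" "\<zero>\<^bsub>D\<^esub> = (\<lambda>c. 0)"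
  by (auto simp: new_descent_algebra_def)

lemma descent_closed:
  "u \<in> carrier D \<Longrightarrow> v \<in> carrier D \<Longrightarrow> (\<lambda>c. u c + v c) \<in> carrier D"
  "u \<in> carrier D \<Longrightarrow> (\<lambda>c. q * u c) \<in> carrier D" "(\<lambda>c. 0) \<in> carrier D" "\<one>\<^bsub>D\<^esub> \<in> carrier D"
  using class_vec_carrier[of \<Delta>] by (auto simp: new_descent_algebra_def)

lemma perm_char_ops:
  "f \<oplus>\<^bsub>P\<^esub> g = (\<lambda>w. f w + g w)" "q \<odot>\<^bsub>P\<^esub> f = (\<lambda>w. q * f w)" "\<zero>\<^bsub>P\<^esub> = (\<lambda>w. 0)"
  "f \<otimes>\<^bsub>P\<^esub> g = (\<lambda>w. f w * g w)" "\<one>\<^bsub>P\<^esub> = (\<lambda>w. of_bool (w \<in> refl_group \<Phi>))"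
  by (auto simp: perm_char_algebra_def)

lemma perm_char_closed:
  "f \<in> carrier P \<Longrightarrow> g \<in> carrier P \<Longrightarrow> (\<lambda>w. f w + g w) \<in> carrier P"
  "f \<in> carrier P \<Longrightarrow> g \<in> carrier P \<Longrightarrow> (\<lambda>w. f w * g w) \<in> carrier P"
  "f \<in> carrier P \<Longrightarrow> (\<lambda>w. q * f w) \<in> carrier P" "(\<lambda>w. 0) \<in> carrier P" "\<one>\<^bsub>P\<^esub> \<in> carrier P"
  unfolding char_map_image_carrier[symmetric]
  using char_map_one descent_closed mult_carrier
    char_map_add[symmetric] char_map_mult[symmetric] char_map_smult[symmetric]
  by (auto intro!: imageI intro: image_eqI[OF _ descent_closed(3)] simp: char_map_zero
      simp flip: char_map_one)

lemma algebra_perm_char: "algebra rat_ring P"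
proof (intro algebraI cring_rat_ring cringI abelian_groupI comm_monoidI)
  show "\<exists>g\<in>carrier P. g \<oplus>\<^bsub>P\<^esub> f = \<zero>\<^bsub>P\<^esub>" if "f \<in> carrier P" for f
    using perm_char_closed(3)[OF that, of "-1"]
    by (intro bexI[of _ "\<lambda>w. - 1 * f w"]) (auto simp: perm_char_ops)
  show "\<one>\<^bsub>P\<^esub> \<otimes>\<^bsub>P\<^esub> f = f" if "f \<in> carrier P" for f
    using that unfolding char_map_image_carrier[symmetric] perm_char_ops
    by (auto simp only: one_mult_char_map)
qed (use perm_char_closed in \<open>auto simp: perm_char_ops rat_ring_def algebra_simps\<close>)

text \<open>Identities in the descent algebra can be checked on characters. This makes the ring laws consequences of
  those for functions, although the product was defined through arbitrary representatives.\<close>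

lemma descent_eqI:
  "u \<in> carrier D \<Longrightarrow> v \<in> carrier D \<Longrightarrow> char_map u = char_map v \<Longrightarrow> u = v"
  using char_map_inj by (rule inj_onD)

lemma algebra_descent: "algebra rat_ring D"
proof (intro algebraI cring_rat_ring cringI abelian_groupI comm_monoidI)
  show "\<exists>g\<in>carrier D. g \<oplus>\<^bsub>D\<^esub> f = \<zero>\<^bsub>D\<^esub>" if "f \<in> carrier D" for f
    using descent_closed(2)[OF that, of "-1"]
    by (intro bexI[of _ "\<lambda>w. - 1 * f w"]) (auto simp: descent_ops)
  show "\<one>\<^bsub>D\<^esub> \<otimes>\<^bsub>D\<^esub> u = u" if "u \<in> carrier D" for u
    by (rule descent_eqI[OF mult_carrier that])
      (simp add: char_map_mult char_map_one perm_char_ops(5) one_mult_char_map del: of_bool_eq)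
  show "u \<otimes>\<^bsub>D\<^esub> v \<otimes>\<^bsub>D\<^esub> w = u \<otimes>\<^bsub>D\<^esub> (v \<otimes>\<^bsub>D\<^esub> w)" for u v w
    by (rule descent_eqI[OF mult_carrier mult_carrier]) (simp add: char_map_mult mult.assoc)
  show "u \<otimes>\<^bsub>D\<^esub> v = v \<otimes>\<^bsub>D\<^esub> u" for u v
    by (rule descent_eqI[OF mult_carrier mult_carrier]) (simp add: char_map_mult mult.commute)
  show "(u \<oplus>\<^bsub>D\<^esub> v) \<otimes>\<^bsub>D\<^esub> w = u \<otimes>\<^bsub>D\<^esub> w \<oplus>\<^bsub>D\<^esub> v \<otimes>\<^bsub>D\<^esub> w" for u v w
    unfolding descent_ops
    by (rule descent_eqI) (simp_all add: mult_carrier descent_closed char_map_mult char_map_add algebra_simps)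
  show "(q \<odot>\<^bsub>D\<^esub> u) \<otimes>\<^bsub>D\<^esub> v = q \<odot>\<^bsub>D\<^esub> (u \<otimes>\<^bsub>D\<^esub> v)" for q u v
    unfolding descent_ops
    by (rule descent_eqI) (simp_all add: mult_carrier descent_closed char_map_mult char_map_smult mult.assoc)
qed (use descent_closed mult_carrier in \<open>auto simp: descent_ops rat_ring_def algebra_simps\<close>)

lemma class_vec_mult:
  assumes "J \<subseteq> \<Delta>" "K \<subseteq> \<Delta>"
  shows "class_vec \<Phi> \<Delta> J \<otimes>\<^bsub>D\<^esub> class_vec \<Phi> \<Delta> K = class_prod \<Phi> \<Delta> J K"
  by (rule descent_eqI)
    (simp_all add: mult_carrier class_prod_carrier char_map_mult char_map_class_vec
      char_map_class_prod assms)

lemma subring_integral_span: "subring (perm_char_span \<int> \<Phi> \<Delta>) P"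
proof -
  interpret algebra rat_ring P by (rule algebra_perm_char)
  have span: "perm_char_span \<int> \<Phi> \<Delta> = char_map ` {u \<in> carrier D. \<forall>c. u c \<in> \<int>}"
    by (rule char_map_image[symmetric]) auto
  have minus: "\<ominus>\<^bsub>P\<^esub> f = (\<lambda>w. - 1 * f w)" if "f \<in> carrier P" for f
    using that perm_char_closed(3)[OF that, of "-1"]
    by (intro M.minus_equality) (auto simp: perm_char_ops)
  have mult_int: "\<forall>c. (u \<otimes>\<^bsub>D\<^esub> v) c \<in> \<int>" if "\<forall>c. u c \<in> \<int>" "\<forall>c. v c \<in> \<int>" for u v
    using that unfolding new_descent_algebra_def class_prod_def class_vec_def
    by (auto intro!: Ints_sum Ints_mult)
  show ?thesis
  proof (rule subringI)
    show "perm_char_span \<int> \<Phi> \<Delta> \<subseteq> carrier P"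
      unfolding span char_map_image_carrier[symmetric] by blast
    have "\<one>\<^bsub>D\<^esub> \<in> {u \<in> carrier D. \<forall>c. u c \<in> \<int>}"
      using descent_closed(4) by (auto simp: new_descent_algebra_def class_vec_def)
    then show "\<one>\<^bsub>P\<^esub> \<in> perm_char_span \<int> \<Phi> \<Delta>"
      unfolding span char_map_one[symmetric] by blast
  next
    fix f assume "f \<in> perm_char_span \<int> \<Phi> \<Delta>"
    then obtain u where u: "u \<in> carrier D" "\<forall>c. u c \<in> \<int>" "f = char_map u"
      unfolding span by blast
    then have "\<ominus>\<^bsub>P\<^esub> f = char_map (\<lambda>c. - 1 * u c)"
      unfolding char_map_smult using minus[of f] char_map_image_carrier by auto
    moreover have "(\<lambda>c. - 1 * u c) \<in> {u \<in> carrier D. \<forall>c. u c \<in> \<int>}"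
      using u descent_closed(2)[of u "-1"] by auto
    ultimately show "\<ominus>\<^bsub>P\<^esub> f \<in> perm_char_span \<int> \<Phi> \<Delta>" unfolding span by blast
  next
    fix f g assume "f \<in> perm_char_span \<int> \<Phi> \<Delta>" "g \<in> perm_char_span \<int> \<Phi> \<Delta>"
    then obtain u v where u: "u \<in> carrier D" "\<forall>c. u c \<in> \<int>" "f = char_map u"
      and v: "v \<in> carrier D" "\<forall>c. v c \<in> \<int>" "g = char_map v"
      unfolding span by blast
    have "f \<otimes>\<^bsub>P\<^esub> g = char_map (u \<otimes>\<^bsub>D\<^esub> v)" "f \<oplus>\<^bsub>P\<^esub> g = char_map (\<lambda>c. u c + v c)"
      using u v by (simp_all add: char_map_mult char_map_add perm_char_ops)
    then show "f \<otimes>\<^bsub>P\<^esub> g \<in> perm_char_span \<int> \<Phi> \<Delta>" "f \<oplus>\<^bsub>P\<^esub> g \<in> perm_char_span \<int> \<Phi> \<Delta>"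
      unfolding span using u v mult_carrier mult_int descent_closed(1) by (auto intro!: imageI)
  qed
qed

lemma char_map_linear: "char_map \<in> linear_maps rat_ring D P"
  using char_map_image_carrier
  by (auto simp: linear_maps_def descent_ops perm_char_ops char_map_add char_map_smult)

text \<open>The basis vectors span the descent algebra, so their images determine a linear map.\<close>

lemma linear_map_eq_char_map:
  assumes \<psi>: "\<psi> \<in> linear_maps rat_ring D P"
    and basis: "\<And>J. J \<subseteq> \<Delta> \<Longrightarrow> \<psi> (class_vec \<Phi> \<Delta> J) = perm_char \<Phi> J"
    and u: "u \<in> carrier D"
  shows "\<psi> u = char_map u"
proof -
  let ?v = "\<lambda>F b. \<Sum>c\<in>F. u c * class_vec \<Phi> \<Delta> (rep c) b"
  have add: "\<psi> (\<lambda>c. x c + y c) = (\<lambda>w. \<psi> x w + \<psi> y w)"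
    if "x \<in> carrier D" "y \<in> carrier D" for x y
    using \<psi> that by (auto simp: linear_maps_def descent_ops perm_char_ops)
  have smult: "\<psi> (\<lambda>c. q * x c) = (\<lambda>w. q * \<psi> x w)" if "x \<in> carrier D" for q x
    using \<psi> that by (auto simp: linear_maps_def descent_ops perm_char_ops rat_ring_def)
  have partial: "?v F \<in> carrier D \<and> \<psi> (?v F) = (\<lambda>w. \<Sum>c\<in>F. u c * perm_char \<Phi> (rep c) w)"
    if "F \<subseteq> Cls" for F
    using finite_subset[OF that finite_classes] that
  proof (induction F rule: finite_induct)
    case empty
    then show ?case using smult[OF descent_closed(3), of 0] descent_closed(3) by simp
  next
    case (insert c F)
    have c: "rep c \<subseteq> \<Delta>" by (rule class_rep(1)) (use insert in simp)
    have "(\<lambda>b. u c * class_vec \<Phi> \<Delta> (rep c) b) \<in> carrier D"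
      by (rule descent_closed(2)[OF class_vec_carrier[OF c]])
    then show ?case
      using insert add[of "\<lambda>b. u c * class_vec \<Phi> \<Delta> (rep c) b" "?v F"]
        smult[OF class_vec_carrier[OF c], of "u c"] basis[OF c]
        descent_closed(1)[of "\<lambda>b. u c * class_vec \<Phi> \<Delta> (rep c) b" "?v F"]
      by simp
  qed
  have "?v Cls = u"
  proof
    fix b
    have "?v Cls b = (\<Sum>c\<in>Cls. if c = b then u b else 0)"
      by (rule sum.cong) (auto simp: class_vec_def class_rep)
    then show "?v Cls b = u b"
      using finite_classes u by (simp add: new_descent_algebra_def)
  qed
  then show ?thesis
    using partial[OF subset_refl] by (simp add: char_map_def)
qed

lemma char_map_ring_iso: "char_map \<in> ring_iso D P"
  using char_map_inj char_map_image_carrier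
  by (auto simp: ring_iso_def bij_betw_def descent_ops perm_char_ops char_map_add char_map_mult
      char_map_one intro!: ring_hom_memI)

theorem descent_algebra_iso_characters:
  "algebra rat_ring D \<and>
   (\<forall>J K. J \<subseteq> \<Delta> \<and> K \<subseteq> \<Delta> \<longrightarrow> class_vec \<Phi> \<Delta> J \<otimes>\<^bsub>D\<^esub> class_vec \<Phi> \<Delta> K = class_prod \<Phi> \<Delta> J K) \<and>
   algebra rat_ring P \<and>
   subring (perm_char_span \<int> \<Phi> \<Delta>) P \<and>
   (\<exists>\<psi>\<in>linear_maps rat_ring D P. \<forall>J. J \<subseteq> \<Delta> \<longrightarrow> \<psi> (class_vec \<Phi> \<Delta> J) = perm_char \<Phi> J) \<and>
   (\<forall>\<psi>\<in>linear_maps rat_ring D P.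
      (\<forall>J. J \<subseteq> \<Delta> \<longrightarrow> \<psi> (class_vec \<Phi> \<Delta> J) = perm_char \<Phi> J) \<longrightarrow>
      \<psi> \<in> ring_iso D P \<and>
      \<psi> ` {u \<in> carrier D. \<forall>c. u c \<in> \<int>} = perm_char_span \<int> \<Phi> \<Delta>)"
proof (intro conjI ballI impI)
  show "\<exists>\<psi>\<in>linear_maps rat_ring D P. \<forall>J. J \<subseteq> \<Delta> \<longrightarrow> \<psi> (class_vec \<Phi> \<Delta> J) = perm_char \<Phi> J"
    using char_map_linear char_map_class_vec by blast
next
  fix \<psi> assume lin: "\<psi> \<in> linear_maps rat_ring D P"
    and basis: "\<forall>J. J \<subseteq> \<Delta> \<longrightarrow> \<psi> (class_vec \<Phi> \<Delta> J) = perm_char \<Phi> J"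
  have eq: "\<psi> u = char_map u" if "u \<in> carrier D" for u
    using linear_map_eq_char_map[OF lin _ that] basis by blast
  have closed: "u \<oplus>\<^bsub>D\<^esub> v \<in> carrier D" "u \<otimes>\<^bsub>D\<^esub> v \<in> carrier D" "\<one>\<^bsub>D\<^esub> \<in> carrier D"
    if "u \<in> carrier D" "v \<in> carrier D" for u v
    using that descent_closed mult_carrier by (auto simp: descent_ops)
  have "bij_betw \<psi> (carrier D) (carrier P)"
    using bij_betw_cong[of "carrier D" \<psi> char_map] eq char_map_ring_iso by (simp add: ring_iso_def)
  moreover have "\<psi> \<in> ring_hom D P"
    using char_map_ring_iso closed descent_closed(4)
    by (auto simp: ring_iso_def ring_hom_def eq)
  ultimately show "\<psi> \<in> ring_iso D P" by (simp add: ring_iso_def)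
  have "\<psi> ` {u \<in> carrier D. \<forall>c. u c \<in> \<int>} = char_map ` {u \<in> carrier D. \<forall>c. u c \<in> \<int>}"
    by (rule image_cong) (auto simp: eq)
  then show "\<psi> ` {u \<in> carrier D. \<forall>c. u c \<in> \<int>} = perm_char_span \<int> \<Phi> \<Delta>"
    using char_map_image[of \<int>] by simp
next
  show "\<forall>J K. J \<subseteq> \<Delta> \<and> K \<subseteq> \<Delta> \<longrightarrow> class_vec \<Phi> \<Delta> J \<otimes>\<^bsub>D\<^esub> class_vec \<Phi> \<Delta> K = class_prod \<Phi> \<Delta> J K"
    using class_vec_mult by blast
qed (rule algebra_descent algebra_perm_char subring_integral_span)+

end

section \<open>The Weyl group of type A\<close>

text \<open>The ambient dimension is called \<open>N\<close> here, so that the index set of the basis is \<open>{1..N}\<close> and that of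
  the simple roots is \<open>{1..<N}\<close>.\<close>

locale type_A =
  fixes e :: "nat \<Rightarrow> 'a::euclidean_space" and N :: nat and \<Phi> \<Delta> :: "'a set"
  assumes dim: "DIM('a) = N"
    and orthonormal: "\<forall>i\<in>{1..N}. \<forall>j\<in>{1..N}. e i \<bullet> e j = (if i = j then 1 else 0)"
    and roots_eq: "\<Phi> = {e i - e j | i j. i \<in> {1..N} \<and> j \<in> {1..N} \<and> i \<noteq> j}"
    and simple_roots_eq: "\<Delta> = (\<lambda>i. e i - e (Suc i)) ` {1..<N}"
begin

abbreviation "W \<equiv> weyl \<Phi>"

definition simple_roots :: "nat set \<Rightarrow> 'a set" where
  "simple_roots S = (\<lambda>i. e i - e (Suc i)) ` S"

text \<open>The linear map that permutes the orthonormal basis by \<open>p\<close>.\<close>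

definition act :: "(nat \<Rightarrow> nat) \<Rightarrow> 'a \<Rightarrow> 'a" where
  "act p v = (\<Sum>i\<in>{1..N}. (v \<bullet> e i) *\<^sub>R e (p i))"

lemma inner_e: "i \<in> {1..N} \<Longrightarrow> j \<in> {1..N} \<Longrightarrow> e i \<bullet> e j = (if i = j then 1 else 0)"
  using orthonormal by blast

lemma e_inj: "inj_on e {1..N}"
  by (rule inj_onI) (metis inner_e zero_neq_one)

text \<open>As many orthonormal vectors as the dimension span the space, so a vector orthogonal to all of them vanishes.\<close>

lemma orthonormal_expansion: "(\<Sum>i\<in>{1..N}. (v \<bullet> e i) *\<^sub>R e i) = v"
proof -
  let ?B = "e ` {1..N}"
  have orth: "pairwise orthogonal ?B"
    by (auto simp: pairwise_def orthogonal_def inner_e)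
  have "0 \<notin> ?B" using inner_e by fastforce
  then have "independent ?B" by (rule pairwise_orthogonal_independent[OF orth])
  moreover have "card ?B = dim (UNIV :: 'a set)" using card_image[OF e_inj] dim by simp
  ultimately have span: "UNIV \<subseteq> span ?B"
    by (intro card_ge_dim_independent) auto
  define u where "u = v - (\<Sum>i\<in>{1..N}. (v \<bullet> e i) *\<^sub>R e i)"
  have "u \<bullet> e j = 0" if "j \<in> {1..N}" for j
  proof -
    have "(\<Sum>i\<in>{1..N}. (v \<bullet> e i) * (e i \<bullet> e j)) = (\<Sum>i\<in>{1..N}. if i = j then v \<bullet> e j else 0)"
      by (rule sum.cong) (auto simp: inner_e[OF _ that])
    then show ?thesis
      using that by (simp add: u_def inner_diff_left inner_sum_left)
  qed
  then have "orthogonal u x" for x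
    using span by (intro orthogonal_to_span[of x ?B]) (auto simp: orthogonal_def)
  then have "u = 0" by (metis orthogonal_self)
  then show ?thesis by (simp add: u_def)
qed

lemma act_e: "i \<in> {1..N} \<Longrightarrow> act p (e i) = e (p i)"
proof -
  assume i: "i \<in> {1..N}"
  have "act p (e i) = (\<Sum>j\<in>{1..N}. if j = i then e (p i) else 0)"
    unfolding act_def by (rule sum.cong) (auto simp: inner_e[OF i])
  then show ?thesis using i by simp
qed

lemma act_linear: "linear (act p)"
  by (rule linearI)
    (simp_all add: act_def inner_add_left scaleR_add_left sum.distrib scaleR_sum_right)

lemma act_diff: "act p (x - y) = act p x - act p y"
  by (rule linear_diff[OF act_linear])

lemma act_comp:
  assumes "q permutes {1..N}"
  shows "act (p \<circ> q) = act p \<circ> act q"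
proof
  fix v
  have "act p (act q v) = (\<Sum>i\<in>{1..N}. (v \<bullet> e i) *\<^sub>R act p (e (q i)))"
    unfolding act_def[of q] by (simp add: linear_sum[OF act_linear] linear_cmul[OF act_linear])
  also have "\<dots> = act (p \<circ> q) v"
    unfolding act_def[of "p \<circ> q"] using permutes_in_image[OF assms]
    by (intro sum.cong) (auto simp: act_e)
  finally show "act (p \<circ> q) v = (act p \<circ> act q) v" by simp
qed

lemma act_id: "act id = id"
  by (rule ext) (simp only: act_def id_apply orthonormal_expansion)

lemma act_inverse:
  assumes "p permutes {1..N}"
  shows "act p \<circ> act (perm_inv p) = id" "act (perm_inv p) \<circ> act p = id"
  using act_comp[OF permutes_inv[OF assms], of p] act_comp[OF assms, of "perm_inv p"]
  by (simp_all add: permutes_inv_o[OF assms] act_id)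

lemma bij_act: "p permutes {1..N} \<Longrightarrow> bij (act p)"
  using act_inverse o_bij by blast

lemma inv_act: "p permutes {1..N} \<Longrightarrow> perm_inv (act p) = act (perm_inv p)"
  using act_inverse by (intro inv_unique_comp)

lemma act_inj:
  assumes p: "p permutes {1..N}" and q: "q permutes {1..N}" and eq: "act p = act q"
  shows "p = q"
proof
  fix i
  show "p i = q i"
  proof (cases "i \<in> {1..N}")
    case True
    then have "e (p i) = e (q i)" using act_e eq by metis
    then show ?thesis
      using inj_onD[OF e_inj] permutes_in_image[OF p] permutes_in_image[OF q] True by blast
  next
    case False
    then show ?thesis using permutes_not_in p q by metis
  qed
qed

lemma inj_on_act: "inj_on act {p. p permutes {1..N}}"
  by (rule inj_onI) (use act_inj in blast)

lemma act_image_iff: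
  assumes "p permutes {1..N}" "\<And>q. q \<in> Q \<Longrightarrow> q permutes {1..N}"
  shows "act p \<in> act ` Q \<longleftrightarrow> p \<in> Q"
  using act_inj assms by blast

lemma reflection_eq_act:
  assumes "i \<in> {1..N}" "j \<in> {1..N}" "i \<noteq> j"
  shows "reflection (e i - e j) = act (transpose i j)"
proof
  fix v
  have "act (transpose i j) v - v =
      (\<Sum>k\<in>{1..N}. (v \<bullet> e k) *\<^sub>R e (transpose i j k)) - (\<Sum>k\<in>{1..N}. (v \<bullet> e k) *\<^sub>R e k)"
    unfolding orthonormal_expansion by (simp add: act_def)
  also have "\<dots> = (\<Sum>k\<in>{1..N}. (if k = i then (v \<bullet> e i) *\<^sub>R (e j - e i) else 0)
      + (if k = j then (v \<bullet> e j) *\<^sub>R (e i - e j) else 0))"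
    unfolding sum_subtractf[symmetric]
    using assms(3) by (intro sum.cong) (auto simp: transpose_def algebra_simps)
  also have "\<dots> = - ((v \<bullet> (e i - e j)) *\<^sub>R (e i - e j))"
    using assms by (simp add: sum.distrib inner_diff_right algebra_simps)
  finally have "act (transpose i j) v = v - (v \<bullet> (e i - e j)) *\<^sub>R (e i - e j)"
    by (metis add_diff_cancel_left' diff_add_cancel uminus_add_conv_diff)
  moreover have "(e i - e j) \<bullet> (e i - e j) = 2"
    using assms by (simp add: inner_diff_left inner_diff_right inner_e)
  ultimately show "reflection (e i - e j) v = act (transpose i j) v"
    by (simp add: reflection_def)
qed

lemma BijGroup_mult: "bij f \<Longrightarrow> bij g \<Longrightarrow> f \<otimes>\<^bsub>BijGroup UNIV\<^esub> g = f \<circ> g"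
  by (simp add: BijGroup_def Bij_def compose_def fun_eq_iff)

lemma BijGroup_inv: "bij f \<Longrightarrow> inv\<^bsub>BijGroup UNIV\<^esub> f = perm_inv f"
  by (simp add: inv_BijGroup Bij_def restrict_UNIV)

lemma BijGroup_one: "\<one>\<^bsub>BijGroup UNIV\<^esub> = id"
  by (simp add: BijGroup_def fun_eq_iff)

text \<open>A set of permutations closed under the group operations contains everything generated by the reflections in it;
  used both for the full symmetric group and for Young subgroups.\<close>

lemma refl_group_subset:
  assumes R: "\<And>r. r \<in> R \<Longrightarrow> \<exists>p\<in>Q. reflection r = act p"
    and Q: "\<And>p. p \<in> Q \<Longrightarrow> p permutes {1..N}" "id \<in> Q"
      "\<And>p. p \<in> Q \<Longrightarrow> perm_inv p \<in> Q" "\<And>p q. p \<in> Q \<Longrightarrow> q \<in> Q \<Longrightarrow> p \<circ> q \<in> Q"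
  shows "refl_group R \<subseteq> act ` Q"
proof
  fix w assume "w \<in> refl_group R"
  then show "w \<in> act ` Q"
    unfolding refl_group_def
  proof induction
    case one
    show ?case unfolding BijGroup_one by (rule image_eqI[where x = id]) (simp_all only: act_id Q(2))
  next
    case (incl h)
    then show ?case using R by auto
  next
    case (inv h)
    then obtain p where "p \<in> Q" "h = act p" using R by auto
    then show ?case using Q bij_act inv_act by (simp add: BijGroup_inv)
  next
    case (eng g h)
    then obtain p q where "p \<in> Q" "g = act p" "q \<in> Q" "h = act q" by blast
    then have "g \<otimes>\<^bsub>BijGroup UNIV\<^esub> h = act (p \<circ> q)" "p \<circ> q \<in> Q"
      using Q bij_act act_comp[of q p] by (simp_all add: BijGroup_mult)
    then show ?case by blast
  qed
qed

lemma reflection_simple: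
  "i \<in> {1..<N} \<Longrightarrow> reflection (e i - e (Suc i)) = act (transpose i (Suc i))"
  by (rule reflection_eq_act) auto

lemma refl_group_simple_roots:
  assumes S: "S \<subseteq> {1..<N}"
  shows "refl_group (simple_roots S) = act ` young N S"
proof
  show "refl_group (simple_roots S) \<subseteq> act ` young N S"
  proof (rule refl_group_subset)
    show "\<exists>p\<in>young N S. reflection r = act p" if r: "r \<in> simple_roots S" for r
    proof -
      obtain i where i: "i \<in> S" "r = e i - e (Suc i)" using r by (auto simp: simple_roots_def)
      then have "reflection r = act (transpose i (Suc i))" using reflection_simple S by blast
      then show ?thesis using young_transpose[OF i(1) S] by blast
    qed
  qed (use young_permutes young_id young_inv young_comp in auto)
  show "act ` young N S \<subseteq> refl_group (simple_roots S)"
  proof clarify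
    fix p assume p: "p \<in> young N S"
    have "p \<in> {q. q permutes {1..N} \<and> act q \<in> refl_group (simple_roots S)}"
    proof (rule young_induct[OF p S])
      show "id \<in> {q. q permutes {1..N} \<and> act q \<in> refl_group (simple_roots S)}"
        using generate.one[of "BijGroup UNIV"]
        by (simp add: permutes_id act_id refl_group_def BijGroup_one)
    next
      fix q i assume q: "q \<in> {q. q permutes {1..N} \<and> act q \<in> refl_group (simple_roots S)}"
        and i: "i \<in> S"
      let ?t = "transpose i (Suc i)"
      have t: "?t permutes {1..N}" by (rule young_permutes[OF young_transpose[OF i S]])
      have "act ?t \<in> refl_group (simple_roots S)"
        unfolding refl_group_def simple_roots_def
        by (rule generate.incl) (use i S reflection_simple in force)
      then have "act ?t \<otimes>\<^bsub>BijGroup UNIV\<^esub> act q \<in> refl_group (simple_roots S)"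
        using q unfolding refl_group_def by (blast intro: generate.eng)
      then show "?t \<circ> q \<in> {q. q permutes {1..N} \<and> act q \<in> refl_group (simple_roots S)}"
        using q t bij_act act_comp[of q ?t] by (simp add: BijGroup_mult permutes_compose)
    qed
    then show "act p \<in> refl_group (simple_roots S)" by blast
  qed
qed

lemma simple_eq: "\<Delta> = simple_roots {1..<N}"
  by (simp add: simple_roots_eq simple_roots_def)

lemma refl_group_all_simple: "refl_group \<Delta> = act ` {p. p permutes {1..N}}"
  unfolding simple_eq refl_group_simple_roots[OF subset_refl]
  using young_full young_permutes by blast

lemma refl_group_roots: "refl_group \<Phi> = act ` {p. p permutes {1..N}}"
proof
  show "refl_group \<Phi> \<subseteq> act ` {p. p permutes {1..N}}"
  proof (rule refl_group_subset)
    show "\<exists>p\<in>{p. p permutes {1..N}}. reflection r = act p" if r: "r \<in> \<Phi>" for r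
    proof -
      obtain i j where ij: "i \<in> {1..N}" "j \<in> {1..N}" "i \<noteq> j" "r = e i - e j"
        using r unfolding roots_eq by blast
      have "transpose i j \<in> {p. p permutes {1..N}}" using permutes_swap_id[OF ij(1,2)] by simp
      then show ?thesis using reflection_eq_act[OF ij(1-3)] ij(4) by blast
    qed
  qed (use permutes_id permutes_inv permutes_compose in auto)
  have "\<Delta> \<subseteq> \<Phi>"
  proof
    fix r assume "r \<in> \<Delta>"
    then obtain i where "i \<in> {1..<N}" "r = e i - e (Suc i)"
      unfolding simple_eq simple_roots_def by blast
    then show "r \<in> \<Phi>"
      unfolding roots_eq by (intro CollectI exI[of _ i] exI[of _ "Suc i"]) auto
  qed
  then have "refl_group \<Delta> \<subseteq> refl_group \<Phi>"
    unfolding refl_group_def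
    by (intro group.mono_generate[OF group_BijGroup]) (rule image_mono)
  then show "act ` {p. p permutes {1..N}} \<subseteq> refl_group \<Phi>"
    by (simp add: refl_group_all_simple)
qed

lemma subset_simple:
  assumes "J \<subseteq> \<Delta>"
  obtains S where "S \<subseteq> {1..<N}" "J = simple_roots S"
  using assms unfolding simple_eq simple_roots_def by (metis subset_image_iff)

lemma simple_roots_subset: "S \<subseteq> {1..<N} \<Longrightarrow> simple_roots S \<subseteq> \<Delta>"
  unfolding simple_eq simple_roots_def by blast

lemma root_eq_iff:
  assumes "i \<in> {1..N}" "j \<in> {1..N}" "k \<in> {1..N}" "l \<in> {1..N}" "i \<noteq> j"
  shows "e i - e j = e k - e l \<longleftrightarrow> i = k \<and> j = l"
proof
  assume eq: "e i - e j = e k - e l"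
  have "(e i - e j) \<bullet> e i = 1" "(e i - e j) \<bullet> e j = -1"
    using assms by (auto simp: inner_diff_left inner_e)
  then show "i = k \<and> j = l"
    unfolding eq using assms by (auto simp: inner_diff_left inner_e split: if_splits)
qed auto

lemma act_root:
  assumes "i \<in> {1..<N}"
  shows "act p (e i - e (Suc i)) = e (p i) - e (p (Suc i))"
  using assms by (simp add: act_diff act_e)

lemma act_simple_root_mem_iff:
  assumes p: "p permutes {1..N}" and i: "i \<in> {1..<N}" and T: "T \<subseteq> {1..<N}"
  shows "act p (e i - e (Suc i)) \<in> simple_roots T \<longleftrightarrow> p i \<in> T \<and> p (Suc i) = Suc (p i)"
proof -
  have "p i \<noteq> p (Suc i)" using injD[OF permutes_inj[OF p], of i "Suc i"] by auto
  then have "e (p i) - e (p (Suc i)) = e k - e (Suc k) \<longleftrightarrow> p i = k \<and> p (Suc i) = Suc k" if "k \<in> T" for k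
    using that T i permutes_in_image[OF p, of i] permutes_in_image[OF p, of "Suc i"]
    by (intro root_eq_iff) auto
  then show ?thesis unfolding act_root[OF i] simple_roots_def by auto
qed

text \<open>The height functional \<open>h\<close> is \<open>1\<close> on every simple root and \<open>j - i\<close> on \<open>e\<^sub>i - e\<^sub>j\<close>, so it is nonnegative on
  positive roots. Conversely \<open>e\<^sub>i - e\<^sub>j\<close> is the telescoping sum of the simple roots from \<open>i\<close> to \<open>j - 1\<close>.\<close>

lemma pos_root_iff:
  assumes i: "i \<in> {1..N}" and j: "j \<in> {1..N}" and ij: "i \<noteq> j"
  shows "e i - e j \<in> pos_roots \<Phi> \<Delta> \<longleftrightarrow> i < j"
proof
  assume "e i - e j \<in> pos_roots \<Phi> \<Delta>"
  then obtain c where c: "\<forall>s\<in>\<Delta>. 0 \<le> c s" "e i - e j = (\<Sum>s\<in>\<Delta>. c s *\<^sub>R s)"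
    unfolding pos_roots_def by blast
  \<comment> \<open>The vector representing the height functional.\<close>
  define h where "h = (\<Sum>k\<in>{1..N}. (- real k) *\<^sub>R e k)"
  have eh: "e k \<bullet> h = - real k" if "k \<in> {1..N}" for k
  proof -
    have "e k \<bullet> h = (\<Sum>l\<in>{1..N}. if l = k then - real k else 0)"
      unfolding h_def inner_sum_right by (rule sum.cong) (auto simp: inner_e[OF that])
    then show ?thesis using that by simp
  qed
  have "s \<bullet> h = 1" if "s \<in> \<Delta>" for s
    using that eh unfolding simple_eq simple_roots_def by (auto simp: inner_diff_left)
  then have "(e i - e j) \<bullet> h = (\<Sum>s\<in>\<Delta>. c s)"
    unfolding c(2) inner_sum_left by (intro sum.cong) auto
  then have "real j - real i \<ge> 0"
    using eh i j c(1) by (simp add: inner_diff_left sum_nonneg)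
  then show "i < j" using ij by simp
next
  assume less: "i < j"
  have "inj_on (\<lambda>k. e k - e (Suc k)) {1..<N}"
    by (rule inj_onI) (subst (asm) root_eq_iff, auto)
  then have inj: "inj_on (\<lambda>k. e k - e (Suc k)) {i..<j}"
    by (rule inj_on_subset) (use i j in auto)
  have sub: "simple_roots {i..<j} \<subseteq> \<Delta>" by (rule simple_roots_subset) (use i j in auto)
  have fin: "finite \<Delta>" unfolding simple_eq simple_roots_def by simp
  have "(\<Sum>s\<in>\<Delta>. of_bool (s \<in> simple_roots {i..<j}) *\<^sub>R s) = (\<Sum>s\<in>simple_roots {i..<j}. s)"
    using sub fin by (intro sum.mono_neutral_cong_right) auto
  also have "\<dots> = (\<Sum>k\<in>{i..<j}. e k - e (Suc k))"
    unfolding simple_roots_def by (simp add: sum.reindex[OF inj])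
  also have "\<dots> = e i - e j"
    using less sum_Suc_diff'[of i j "\<lambda>k. - e k"] by simp
  finally have "e i - e j = (\<Sum>s\<in>\<Delta>. of_bool (s \<in> simple_roots {i..<j}) *\<^sub>R s)" by simp
  moreover have "e i - e j \<in> \<Phi>" using i j ij unfolding roots_eq by blast
  ultimately show "e i - e j \<in> pos_roots \<Phi> \<Delta>"
    unfolding pos_roots_def
    by (auto intro!: exI[of _ "\<lambda>s. of_bool (s \<in> simple_roots {i..<j})"])
qed

lemma dist_reps_simple_roots:
  assumes S: "S \<subseteq> {1..<N}"
  shows "dist_reps \<Phi> \<Delta> (simple_roots S) = act ` {p. p permutes {1..N} \<and> ascending S p}"
proof -
  have "act p ` simple_roots S \<subseteq> pos_roots \<Phi> \<Delta> \<longleftrightarrow> ascending S p" if p: "p permutes {1..N}" for p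
  proof -
    have "act p (e i - e (Suc i)) \<in> pos_roots \<Phi> \<Delta> \<longleftrightarrow> p i \<le> p (Suc i)" if "i \<in> S" for i
    proof -
      have "p i \<noteq> p (Suc i)" using injD[OF permutes_inj[OF p], of i "Suc i"] by auto
      moreover have i: "i \<in> {1..<N}" using that S by blast
      moreover have "p i \<in> {1..N}" "p (Suc i) \<in> {1..N}"
        using permutes_in_image[OF p] i by auto
      ultimately show ?thesis using act_root[OF i] pos_root_iff by auto
    qed
    then show ?thesis unfolding simple_roots_def ascending_def by blast
  qed
  then have "{p \<in> {p. p permutes {1..N}}. act p ` simple_roots S \<subseteq> pos_roots \<Phi> \<Delta>}
      = {p. p permutes {1..N} \<and> ascending S p}" by (simp cong: conj_cong)
  moreover have "{w \<in> act ` A. Q w} = act ` {p \<in> A. Q (act p)}" for A Q by blast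
  ultimately show ?thesis
    unfolding dist_reps_def refl_group_roots by (simp only:)
qed

lemma double_reps_simple_roots:
  assumes S: "S \<subseteq> {1..<N}" and T: "T \<subseteq> {1..<N}"
  shows "double_reps \<Phi> \<Delta> (simple_roots T) (simple_roots S) =
    act ` {d. d permutes {1..N} \<and> ascending S d \<and> ascending T (perm_inv d)}"
proof -
  have "perm_inv ` dist_reps \<Phi> \<Delta> (simple_roots T) =
      act ` {d. d permutes {1..N} \<and> ascending T (perm_inv d)}" (is "?A = ?B")
  proof
    show "?A \<subseteq> ?B"
      unfolding dist_reps_simple_roots[OF T]
    proof clarify
      fix p assume p: "p permutes {1..N}" "ascending T p"
      then have "perm_inv p \<in> {d. d permutes {1..N} \<and> ascending T (perm_inv d)}"
        using permutes_inv permutes_inv_inv by (metis mem_Collect_eq)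
      then show "perm_inv (act p) \<in> ?B" unfolding inv_act[OF p(1)] by (rule imageI)
    qed
    show "?B \<subseteq> ?A"
    proof clarify
      fix d assume d: "d permutes {1..N}" "ascending T (perm_inv d)"
      have "act d = perm_inv (act (perm_inv d))"
        using inv_act[OF permutes_inv[OF d(1)]] permutes_inv_inv[OF d(1)] by simp
      then show "act d \<in> ?A"
        unfolding dist_reps_simple_roots[OF T] using d permutes_inv by blast
    qed
  qed
  then show ?thesis
    unfolding double_reps_def dist_reps_simple_roots[OF S]
    using inj_on_image_Int[OF inj_on_act, of "{d. d permutes {1..N} \<and> ascending T (perm_inv d)}"
        "{p. p permutes {1..N} \<and> ascending S p}"]
    by (auto simp: Collect_conj_eq[symmetric] conj_ac)
qed

lemma simple_roots_inter_double_rep: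
  assumes S: "S \<subseteq> {1..<N}" and T: "T \<subseteq> {1..<N}" and d: "d permutes {1..N}"
  shows "perm_inv (act d) ` simple_roots T \<inter> simple_roots S =
    simple_roots {i \<in> S. d i \<in> T \<and> d (Suc i) = Suc (d i)}"
proof -
  have "x \<in> perm_inv (act d) ` X \<longleftrightarrow> act d x \<in> X" for x X
  proof
    assume "x \<in> perm_inv (act d) ` X"
    then show "act d x \<in> X"
      using surj_f_inv_f[OF bij_is_surj[OF bij_act[OF d]]] by auto
  next
    assume "act d x \<in> X"
    then show "x \<in> perm_inv (act d) ` X"
      using inv_f_f[OF bij_is_inj[OF bij_act[OF d]], of x] by (metis imageI)
  qed
  note mem = this
  have "e i - e (Suc i) \<in> perm_inv (act d) ` simple_roots T \<longleftrightarrow> d i \<in> T \<and> d (Suc i) = Suc (d i)"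
    if "i \<in> S" for i
    unfolding mem by (rule act_simple_root_mem_iff[OF d _ T]) (use S that in blast)
  moreover have "A \<inter> f ` S = f ` {i \<in> S. Q i}" if "\<And>i. i \<in> S \<Longrightarrow> f i \<in> A \<longleftrightarrow> Q i"
    for A Q and f :: "nat \<Rightarrow> 'a"
    using that by auto
  ultimately show ?thesis
    unfolding simple_roots_def[of S] simple_roots_def[of "{i \<in> S. _ i}"] by simp
qed

lemma simple_root_inj: "inj_on (\<lambda>i. e i - e (Suc i)) {1..<N}"
  by (rule inj_onI) (subst (asm) root_eq_iff, auto)

lemma simple_roots_inj:
  assumes "S \<subseteq> {1..<N}" "T \<subseteq> {1..<N}" "simple_roots S = simple_roots T"
  shows "S = T"
proof -
  show ?thesis
    using inj_on_image_eq_iff[OF simple_root_inj assms(1,2)] assms(3) by (simp add: simple_roots_def)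
qed

section \<open>Permutation characters of parabolic subgroups\<close>

lemma W_carrier_one:
  "carrier W = act ` {p. p permutes {1..N}}" "\<one>\<^bsub>W\<^esub> = id"
  by (simp_all add: weyl_def refl_group_roots BijGroup_one)

lemma act_carrier: "p permutes {1..N} \<Longrightarrow> act p \<in> carrier W"
  by (simp add: W_carrier_one)

lemma W_mult:
  assumes "p permutes {1..N}" "q permutes {1..N}"
  shows "act p \<otimes>\<^bsub>W\<^esub> act q = act (p \<circ> q)"
  using assms by (simp add: weyl_def BijGroup_mult bij_act act_comp)

lemma subgroup_refl_group:
  assumes "R \<subseteq> \<Phi>"
  shows "subgroup (refl_group R) (BijGroup UNIV)"
  unfolding refl_group_def
proof (rule group.generate_is_subgroup[OF group_BijGroup])
  have "bij (reflection r)" if r: "r \<in> R" for r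
  proof -
    obtain i j where ij: "i \<in> {1..N}" "j \<in> {1..N}" "i \<noteq> j" "r = e i - e j"
      using r assms unfolding roots_eq by blast
    show ?thesis
      unfolding ij(4) reflection_eq_act[OF ij(1-3)] by (rule bij_act[OF permutes_swap_id[OF ij(1,2)]])
  qed
  then show "reflection ` R \<subseteq> carrier (BijGroup UNIV)"
    by (auto simp: BijGroup_def Bij_def)
qed

lemma group_W: "group W"
  unfolding weyl_def
  by (rule subgroup.subgroup_is_group[OF subgroup_refl_group[OF subset_refl] group_BijGroup])

lemma W_inv:
  assumes "p permutes {1..N}"
  shows "inv\<^bsub>W\<^esub> (act p) = act (perm_inv p)"
proof (rule group.inv_equality[OF group_W])
  show "act (perm_inv p) \<otimes>\<^bsub>W\<^esub> act p = \<one>\<^bsub>W\<^esub>"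
    using W_mult[OF permutes_inv[OF assms] assms] by (simp add: permutes_inv_o[OF assms] act_id W_carrier_one)
qed (use assms permutes_inv act_carrier in auto)

lemma finite_W: "finite (carrier W)"
  by (simp add: W_carrier_one finite_permutations)

lemma simple_subset_roots: "\<Delta> \<subseteq> \<Phi>"
proof
  fix r assume "r \<in> \<Delta>"
  then obtain i where "i \<in> {1..<N}" "r = e i - e (Suc i)"
    unfolding simple_eq simple_roots_def by blast
  then show "r \<in> \<Phi>"
    unfolding roots_eq by (intro CollectI exI[of _ i] exI[of _ "Suc i"]) auto
qed

lemma subgroup_parabolic:
  assumes "J \<subseteq> \<Delta>"
  shows "subgroup (refl_group J) W"
  unfolding weyl_def
proof (rule group.subgroup_incl[OF group_BijGroup])
  have J: "J \<subseteq> \<Phi>" using assms simple_subset_roots by blast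
  show "subgroup (refl_group J) (BijGroup UNIV)" by (rule subgroup_refl_group[OF J])
  show "subgroup (refl_group \<Phi>) (BijGroup UNIV)" by (rule subgroup_refl_group) simp
  show "refl_group J \<subseteq> refl_group \<Phi>"
    unfolding refl_group_def using J by (intro group.mono_generate[OF group_BijGroup] image_mono)
qed

lemma perm_char_eq_card:
  "w \<in> carrier W \<Longrightarrow> perm_char \<Phi> J w = of_nat (card (fixed_lcosets W (refl_group J) w))"
  by (simp add: perm_char_def fixed_lcosets_def weyl_def)

lemma perm_char_outside: "w \<notin> carrier W \<Longrightarrow> perm_char \<Phi> J w = 0"
  by (simp add: perm_char_def weyl_def)

lemma act_mem_parabolic_iff:
  assumes "S \<subseteq> {1..<N}" "p permutes {1..N}"
  shows "act p \<in> refl_group (simple_roots S) \<longleftrightarrow> p \<in> young N S"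
  unfolding refl_group_simple_roots[OF assms(1)]
  by (rule act_image_iff[OF assms(2) young_permutes])

lemma W_conjugate:
  assumes "p permutes {1..N}" "q permutes {1..N}"
  shows "act p \<otimes>\<^bsub>W\<^esub> act q \<otimes>\<^bsub>W\<^esub> inv\<^bsub>W\<^esub> (act p) = act (p \<circ> q \<circ> perm_inv p)"
  using assms by (simp add: W_inv W_mult permutes_compose permutes_inv)

lemma W_conj_act_iff: "W_conj \<Phi> J K \<longleftrightarrow> (\<exists>p. p permutes {1..N} \<and> act p ` J = K)"
  unfolding W_conj_def refl_group_roots by simp

lemma W_conj_iff:
  assumes S: "S \<subseteq> {1..<N}" and T: "T \<subseteq> {1..<N}"
  shows "W_conj \<Phi> (simple_roots S) (simple_roots T) \<longleftrightarrow>
    (\<exists>p. p permutes {1..N} \<and> p ` S = T \<and> (\<forall>i\<in>S. p (Suc i) = Suc (p i)))"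
proof -
  have "act p ` simple_roots S = simple_roots T \<longleftrightarrow> p ` S = T \<and> (\<forall>i\<in>S. p (Suc i) = Suc (p i))"
    if p: "p permutes {1..N}" for p
  proof -
    have image: "act p ` simple_roots S = simple_roots (p ` S)" if "\<forall>i\<in>S. p (Suc i) = Suc (p i)"
    proof -
      have "act p (e i - e (Suc i)) = e (p i) - e (Suc (p i))" if "i \<in> S" for i
        using act_root[of i p] that S \<open>\<forall>i\<in>S. p (Suc i) = Suc (p i)\<close> by auto
      then show ?thesis unfolding simple_roots_def image_image by (rule image_cong[OF refl])
    qed
    show ?thesis
    proof
      assume eq: "act p ` simple_roots S = simple_roots T"
      have mem: "p i \<in> T \<and> p (Suc i) = Suc (p i)" if "i \<in> S" for i
      proof -
        have "act p (e i - e (Suc i)) \<in> simple_roots T"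
          unfolding eq[symmetric] simple_roots_def[of S] using that by (intro imageI)
        then show ?thesis using act_simple_root_mem_iff[OF p _ T] that S by blast
      qed
      have "p ` S \<subseteq> {1..<N}" using mem T by blast
      then have "p ` S = T"
        using simple_roots_inj[OF _ T] image mem eq by metis
      then show "p ` S = T \<and> (\<forall>i\<in>S. p (Suc i) = Suc (p i))" using mem by blast
    qed (use image in auto)
  qed
  then show ?thesis
    unfolding W_conj_act_iff by (simp cong: conj_cong)
qed

lemma perm_char_W_conj:
  assumes J: "J \<subseteq> \<Delta>" and K: "K \<subseteq> \<Delta>" and conj: "W_conj \<Phi> J K"
  shows "perm_char \<Phi> J = perm_char \<Phi> K"
proof
  fix w
  obtain S T where S: "S \<subseteq> {1..<N}" "J = simple_roots S" and T: "T \<subseteq> {1..<N}" "K = simple_roots T"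
    using subset_simple[OF J] subset_simple[OF K] by metis
  obtain p where p: "p permutes {1..N}" "p ` S = T" "\<forall>i\<in>S. p (Suc i) = Suc (p i)"
    using conj W_conj_iff[OF S(1) T(1)] unfolding S T by blast
  have inv_shift: "perm_inv p j \<in> S \<and> perm_inv p (Suc j) = Suc (perm_inv p j)" if j: "j \<in> T" for j
  proof -
    obtain i where "i \<in> S" "j = p i" using j p(2) by blast
    then show ?thesis using p(3) permutes_inverses(2)[OF p(1)] by metis
  qed
  have young_iff: "p \<circ> q \<circ> perm_inv p \<in> young N T \<longleftrightarrow> q \<in> young N S" for q
  proof
    assume "p \<circ> q \<circ> perm_inv p \<in> young N T"
    from young_conjugate[OF permutes_inv[OF p(1)] inv_shift this]
    show "q \<in> young N S"
      using permutes_inverses[OF p(1)] by (simp add: permutes_inv_inv[OF p(1)] o_def)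
  qed (rule young_conjugate[OF p(1)], use p in auto)
  show "perm_char \<Phi> J w = perm_char \<Phi> K w"
  proof (cases "w \<in> carrier W")
    case True
    have "card (fixed_lcosets W (refl_group J) w) = card (fixed_lcosets W (refl_group K) w)"
    proof (rule group.card_fixed_lcosets_conjugate[OF group_W finite_W _ _ True])
      fix x assume "x \<in> carrier W"
      then obtain q where q: "x = act q" "q permutes {1..N}" by (auto simp: W_carrier_one)
      have "p \<circ> q \<circ> perm_inv p permutes {1..N}"
        using p(1) q(2) permutes_compose permutes_inv by metis
      then show "act p \<otimes>\<^bsub>W\<^esub> x \<otimes>\<^bsub>W\<^esub> inv\<^bsub>W\<^esub> (act p) \<in> refl_group K \<longleftrightarrow> x \<in> refl_group J"
        unfolding q(1) W_conjugate[OF p(1) q(2)] S T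
        by (simp only: act_mem_parabolic_iff[OF T(1)] act_mem_parabolic_iff[OF S(1) q(2)] young_iff)
    qed (use J K subgroup_parabolic act_carrier[OF p(1)] in auto)
    then show ?thesis using True by (simp add: perm_char_eq_card)
  qed (simp add: perm_char_outside)
qed

lemma parabolic_inter_conjugate:
  assumes J: "J \<subseteq> \<Delta>" and K: "K \<subseteq> \<Delta>" and d: "d \<in> double_reps \<Phi> \<Delta> J K"
  shows "{k \<in> refl_group K. d \<otimes>\<^bsub>W\<^esub> k \<otimes>\<^bsub>W\<^esub> inv\<^bsub>W\<^esub> d \<in> refl_group J} =
    refl_group (perm_inv d ` J \<inter> K)"
proof -
  obtain S T where S: "S \<subseteq> {1..<N}" "K = simple_roots S" and T: "T \<subseteq> {1..<N}" "J = simple_roots T"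
    using subset_simple[OF J] subset_simple[OF K] by metis
  obtain p where p: "p permutes {1..N}" "ascending S p" "ascending T (perm_inv p)" "d = act p"
    using d double_reps_simple_roots[OF S(1) T(1)] unfolding S T by auto
  let ?L = "{i \<in> S. p i \<in> T \<and> p (Suc i) = Suc (p i)}"
  have L: "?L \<subseteq> {1..<N}" using S(1) by blast
  have conj: "act p \<otimes>\<^bsub>W\<^esub> act q \<otimes>\<^bsub>W\<^esub> inv\<^bsub>W\<^esub> (act p) \<in> act ` young N T \<longleftrightarrow>
      p \<circ> q \<circ> perm_inv p \<in> young N T" if "q permutes {1..N}" for q
    unfolding W_conjugate[OF p(1) that]
    by (rule act_image_iff[OF _ young_permutes])
      (use p(1) that permutes_compose permutes_inv in metis)
  have "act ` {q \<in> young N S. p \<circ> q \<circ> perm_inv p \<in> young N T} = act ` young N ?L"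
    using young_inter_conjugate[OF p(1-3)] young_permutes by blast
  moreover have "{k \<in> act ` young N S. act p \<otimes>\<^bsub>W\<^esub> k \<otimes>\<^bsub>W\<^esub> inv\<^bsub>W\<^esub> (act p) \<in> act ` young N T} =
      act ` {q \<in> young N S. p \<circ> q \<circ> perm_inv p \<in> young N T}"
    using conj young_permutes by blast
  ultimately show ?thesis
    unfolding S T p(4) simple_roots_inter_double_rep[OF S(1) T(1) p(1)]
      refl_group_simple_roots[OF S(1)] refl_group_simple_roots[OF T(1)] refl_group_simple_roots[OF L]
    by simp
qed

text \<open>Mackey's formula with the distinguished double coset representatives, with the terms grouped by \<open>L\<close>.\<close>

lemma perm_char_product:
  assumes J: "J \<subseteq> \<Delta>" and K: "K \<subseteq> \<Delta>"
  shows "perm_char \<Phi> J w * perm_char \<Phi> K w =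
    (\<Sum>L\<in>Pow K. of_nat (struct_const \<Phi> \<Delta> J K L) * perm_char \<Phi> L w)"
proof (cases "w \<in> carrier W")
  case True
  obtain S T where S: "S \<subseteq> {1..<N}" "K = simple_roots S" and T: "T \<subseteq> {1..<N}" "J = simple_roots T"
    using subset_simple[OF J] subset_simple[OF K] by metis
  let ?D = "double_reps \<Phi> \<Delta> J K"
  have D: "?D = act ` {d. d permutes {1..N} \<and> ascending S d \<and> ascending T (perm_inv d)}"
    unfolding S T by (rule double_reps_simple_roots[OF S(1) T(1)])
  have DW: "?D \<subseteq> carrier W" unfolding D W_carrier_one by blast
  have finD: "finite ?D" using finite_subset[OF DW finite_W] .
  have "finite K" unfolding S simple_roots_def using finite_subset[OF S(1)] by simp
  have HJ: "refl_group J = act ` young N T" and HK: "refl_group K = act ` young N S"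
    unfolding S T by (rule refl_group_simple_roots, fact)+
  have "card (fixed_lcosets W (refl_group J) w) * card (fixed_lcosets W (refl_group K) w) =
      (\<Sum>d\<in>?D. card (fixed_lcosets W {k \<in> refl_group K. d \<otimes>\<^bsub>W\<^esub> k \<otimes>\<^bsub>W\<^esub> inv\<^bsub>W\<^esub> d \<in> refl_group J} w))"
  proof (rule group.card_fixed_lcosets_mult[OF group_W finite_W _ _ True DW])
    fix g assume "g \<in> carrier W"
    then obtain p where p: "g = act p" "p permutes {1..N}" by (auto simp: W_carrier_one)
    obtain u v d where u: "u \<in> young N T" and v: "v \<in> young N S"
      and d: "d permutes {1..N}" "ascending S d" "ascending T (perm_inv d)" "p = u \<circ> d \<circ> v"
      using double_coset_rep_exists[OF p(2) S(1) T(1)] by blast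
    have "g = act u \<otimes>\<^bsub>W\<^esub> act d \<otimes>\<^bsub>W\<^esub> act v"
      using young_permutes[OF u] young_permutes[OF v] d(1)
      by (simp add: p(1) d(4) W_mult permutes_compose)
    moreover have "act d \<in> ?D" unfolding D using d by blast
    ultimately show "\<exists>d\<in>?D. \<exists>h\<in>refl_group J. \<exists>k\<in>refl_group K. g = h \<otimes>\<^bsub>W\<^esub> d \<otimes>\<^bsub>W\<^esub> k"
      unfolding HJ HK using u v by blast
  next
    fix x y h k
    assume "x \<in> ?D" "y \<in> ?D" and "h \<in> refl_group J" "k \<in> refl_group K"
      and eq: "y = h \<otimes>\<^bsub>W\<^esub> x \<otimes>\<^bsub>W\<^esub> k"
    then obtain d d' u v where
      d: "d permutes {1..N}" "ascending S d" "ascending T (perm_inv d)" "x = act d" and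
      d': "d' permutes {1..N}" "ascending S d'" "ascending T (perm_inv d')" "y = act d'" and
      u: "u \<in> young N T" "h = act u" and v: "v \<in> young N S" "k = act v"
      unfolding D HJ HK by blast
    have "act d' = act (u \<circ> d \<circ> v)"
      using eq young_permutes[OF u(1)] young_permutes[OF v(1)] d(1)
      by (simp add: d(4) d'(4) u(2) v(2) W_mult permutes_compose)
    then have "d' = u \<circ> d \<circ> v"
      using young_permutes[OF u(1)] young_permutes[OF v(1)] d(1) d'(1)
      by (intro act_inj permutes_compose)
    then show "y = x"
      unfolding d(4) d'(4) using double_coset_rep_unique[OF u(1) v(1) _ d(1-3) d'(1-3)] by simp
  qed (use J K subgroup_parabolic in auto)
  also have "\<dots> = (\<Sum>d\<in>?D. card (fixed_lcosets W (refl_group (perm_inv d ` J \<inter> K)) w))"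
    using parabolic_inter_conjugate[OF J K] by simp
  also have "\<dots> = (\<Sum>L\<in>Pow K. \<Sum>d\<in>{d \<in> ?D. perm_inv d ` J \<inter> K = L}.
      card (fixed_lcosets W (refl_group (perm_inv d ` J \<inter> K)) w))"
    by (rule sum.group[symmetric]) (use finD \<open>finite K\<close> in auto)
  also have "\<dots> = (\<Sum>L\<in>Pow K. struct_const \<Phi> \<Delta> J K L * card (fixed_lcosets W (refl_group L) w))"
    by (rule sum.cong) (auto simp: struct_const_def)
  finally have "rat_of_nat (card (fixed_lcosets W (refl_group J) w) * card (fixed_lcosets W (refl_group K) w)) =
    rat_of_nat (\<Sum>L\<in>Pow K. struct_const \<Phi> \<Delta> J K L * card (fixed_lcosets W (refl_group L) w))"
    by (rule arg_cong)
  then show ?thesis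
    using True by (simp add: perm_char_eq_card)
qed (simp add: perm_char_outside)

lemma perm_char_all_simple: "perm_char \<Phi> \<Delta> w = of_bool (w \<in> refl_group \<Phi>)"
proof (cases "w \<in> carrier W")
  case True
  have eq: "refl_group \<Delta> = carrier W" by (simp add: W_carrier_one refl_group_all_simple)
  have coset: "x <#\<^bsub>W\<^esub> carrier W = carrier W" if "x \<in> carrier W" for x
    using group.coset_join3[OF group_W that group.subgroup_self[OF group_W] that] .
  have "fixed_lcosets W (carrier W) w = {carrier W}"
    using coset True unfolding fixed_lcosets_def LCOSETS_def by auto
  then show ?thesis
    using True by (simp add: perm_char_eq_card eq) (simp add: weyl_def)
qed (simp add: perm_char_outside, simp add: weyl_def)

section \<open>Classes and linear independence\<close>

text \<open>The simple reflection at \<open>i\<close> lies in \<open>X\<^sub>J\<close> exactly if the root \<open>e\<^sub>i - e\<^bsub>i+1\<^esub>\<close> is not in \<open>J\<close>, so \<open>x\<^sub>J\<close>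
  determines \<open>J\<close>.\<close>

lemma x_elem_inj:
  assumes J: "J \<subseteq> \<Delta>" and K: "K \<subseteq> \<Delta>" and eq: "x_elem \<Phi> \<Delta> J = x_elem \<Phi> \<Delta> K"
  shows "J = K"
proof -
  obtain S T where S: "S \<subseteq> {1..<N}" "J = simple_roots S" and T: "T \<subseteq> {1..<N}" "K = simple_roots T"
    using subset_simple[OF J] subset_simple[OF K] by metis
  have iff: "act (transpose i (Suc i)) \<in> dist_reps \<Phi> \<Delta> (simple_roots S) \<longleftrightarrow> i \<notin> S"
    if S: "S \<subseteq> {1..<N}" and i: "i \<in> {1..<N}" for S i
  proof -
    have "transpose i (Suc i) permutes {1..N}" using i by (intro permutes_swap_id) auto
    moreover have "ascending S (transpose i (Suc i)) \<longleftrightarrow> i \<notin> S"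
      unfolding ascending_def by (auto simp: transpose_def)
    ultimately show ?thesis
      unfolding dist_reps_simple_roots[OF S] by (subst act_image_iff) auto
  qed
  have "dist_reps \<Phi> \<Delta> J = dist_reps \<Phi> \<Delta> K"
    using fun_cong[OF eq] by (auto simp: x_elem_def of_bool_eq_iff)
  then have "i \<in> S \<longleftrightarrow> i \<in> T" if "i \<in> {1..<N}" for i
    using iff[OF S(1) that] iff[OF T(1) that] unfolding S T by simp
  then have "S = T" using S(1) T(1) by blast
  then show ?thesis unfolding S T by simp
qed

lemma W_conj_refl: "W_conj \<Phi> J J"
  unfolding W_conj_act_iff by (rule exI[of _ id]) (simp add: act_id permutes_id)

lemma W_conj_sym:
  assumes "W_conj \<Phi> J K"
  shows "W_conj \<Phi> K J"
proof -
  obtain p where p: "p permutes {1..N}" "act p ` J = K"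
    using assms unfolding W_conj_act_iff by blast
  have "act (perm_inv p) ` K = (act (perm_inv p) \<circ> act p) ` J"
    unfolding p(2)[symmetric] by (rule image_comp)
  then have "act (perm_inv p) ` K = J" by (simp add: act_inverse[OF p(1)])
  then show ?thesis
    unfolding W_conj_act_iff using permutes_inv[OF p(1)] by blast
qed

lemma W_conj_trans:
  assumes "W_conj \<Phi> J K" "W_conj \<Phi> K L"
  shows "W_conj \<Phi> J L"
proof -
  obtain p q where p: "p permutes {1..N}" "act p ` J = K" and q: "q permutes {1..N}" "act q ` K = L"
    using assms unfolding W_conj_act_iff by blast
  have "act (q \<circ> p) ` J = L"
    unfolding act_comp[OF p(1)] image_comp[symmetric] p(2) q(2) ..
  then show ?thesis
    unfolding W_conj_act_iff using permutes_compose[OF p(1) q(1)] by blast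
qed

lemma x_class_eq_iff:
  assumes J: "J \<subseteq> \<Delta>" and K: "K \<subseteq> \<Delta>"
  shows "x_class \<Phi> \<Delta> J = x_class \<Phi> \<Delta> K \<longleftrightarrow> W_conj \<Phi> J K"
proof
  assume eq: "x_class \<Phi> \<Delta> J = x_class \<Phi> \<Delta> K"
  have "x_elem \<Phi> \<Delta> J \<in> x_class \<Phi> \<Delta> J"
    unfolding x_class_def using J W_conj_refl by blast
  then obtain L where "x_elem \<Phi> \<Delta> J = x_elem \<Phi> \<Delta> L" "L \<subseteq> \<Delta>" "W_conj \<Phi> L K"
    unfolding eq unfolding x_class_def by blast
  then show "W_conj \<Phi> J K" using x_elem_inj[OF J] by blast
next
  assume "W_conj \<Phi> J K"
  then have "W_conj \<Phi> L J \<longleftrightarrow> W_conj \<Phi> L K" for L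
    using W_conj_sym W_conj_trans by blast
  then show "x_class \<Phi> \<Delta> J = x_class \<Phi> \<Delta> K" unfolding x_class_def by simp
qed

text \<open>The element is a Coxeter element of \<open>W\<^sub>J\<close>, so it fixes the coset \<open>W\<^sub>J\<close>. If it fixes a coset \<open>g W\<^sub>K\<close>, then
  \<open>g\<^sup>-\<^sup>1\<close> maps the blocks of \<open>J\<close> into blocks of \<open>K\<close>, so some element of \<open>W\<close> maps \<open>J\<close> into \<open>K\<close>; by
  cardinality it maps \<open>J\<close> onto \<open>K\<close>.\<close>

lemma ex_char_separating_element:
  assumes J: "J \<subseteq> \<Delta>"
  shows "\<exists>w. perm_char \<Phi> J w \<noteq> 0 \<and>
    (\<forall>K\<subseteq>\<Delta>. card K \<le> card J \<longrightarrow> perm_char \<Phi> K w \<noteq> 0 \<longrightarrow> W_conj \<Phi> J K)"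
proof -
  obtain S where S: "S \<subseteq> {1..<N}" "J = simple_roots S" using subset_simple[OF J] by blast
  obtain c where c: "c \<in> young N S"
    and cox: "\<And>f :: nat \<Rightarrow> nat. (\<forall>j. f (c j) = f j) \<Longrightarrow> \<forall>i\<in>S. f (Suc i) = f i"
    using ex_coxeter_element[OF S(1)] by blast
  have cp: "c permutes {1..N}" by (rule young_permutes[OF c])
  have cW: "act c \<in> carrier W" by (rule act_carrier[OF cp])
  have fin: "finite (fixed_lcosets W (refl_group K) (act c))" if "K \<subseteq> \<Delta>" for K
    by (rule group.finite_fixed_lcosets[OF group_W finite_W subgroup_parabolic[OF that]])
  have "act c \<in> refl_group J" unfolding S act_mem_parabolic_iff[OF S(1) cp] by (rule c)
  then have "refl_group J \<in> fixed_lcosets W (refl_group J) (act c)"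
    using group.mem_fixed_lcosets_iff[OF group_W subgroup_parabolic[OF J] cW]
      group.coset_join3[OF group_W _ subgroup_parabolic[OF J]] subgroup.one_closed[OF subgroup_parabolic[OF J]]
      group.is_monoid[OF group_W] monoid.one_closed monoid.r_one cW
    by (metis (no_types, lifting))
  then have nonzero: "perm_char \<Phi> J (act c) \<noteq> 0"
    using fin[OF J] cW by (auto simp: perm_char_eq_card)
  have "W_conj \<Phi> J K" if K: "K \<subseteq> \<Delta>" "card K \<le> card J" "perm_char \<Phi> K (act c) \<noteq> 0" for K
  proof -
    obtain T where T: "T \<subseteq> {1..<N}" "K = simple_roots T" using subset_simple[OF K(1)] by blast
    have "fixed_lcosets W (refl_group K) (act c) \<noteq> {}"
      using K(3) cW by (auto simp: perm_char_eq_card)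
    then obtain x where x: "x \<in> carrier W" "act c \<otimes>\<^bsub>W\<^esub> x \<in> x <#\<^bsub>W\<^esub> refl_group K"
      using group.mem_fixed_lcosets_iff[OF group_W subgroup_parabolic[OF K(1)] cW] by blast
    then obtain g where g: "g permutes {1..N}" "x = act g" by (auto simp: W_carrier_one)
    obtain t where t: "t \<in> young N T" "act c \<otimes>\<^bsub>W\<^esub> act g = act g \<otimes>\<^bsub>W\<^esub> act t"
      using x(2) unfolding g T refl_group_simple_roots[OF T(1)] l_coset_def by blast
    have "c \<circ> g = g \<circ> t"
      using t(2) g(1) cp young_permutes[OF t(1)] by (intro act_inj) (auto simp: W_mult permutes_compose)
    then have "perm_inv g (c (g j)) = t j" for j
      using permutes_inverses(2)[OF g(1)] by (metis comp_apply)
    then have "block T (perm_inv g (c j)) = block T (perm_inv g j)" for j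
      using young_block[OF t(1)] permutes_inverses(1)[OF g(1)] by metis
    then have into: "block T (perm_inv g (Suc i)) = block T (perm_inv g i)" if "i \<in> S" for i
      using cox[of "\<lambda>i. block T (perm_inv g i)"] that by blast
    obtain h where h: "h permutes {1..N}" "\<forall>i\<in>S. h i \<in> T \<and> h (Suc i) = Suc (h i)"
      using ex_shift_if_blocks_map_into_blocks[OF permutes_inv[OF g(1)] S(1) T(1) into] by blast
    have "card J = card S" "card K = card T"
      unfolding S T simple_roots_def
      using card_image[of "\<lambda>i. e i - e (Suc i)"] inj_on_subset[OF simple_root_inj] S(1) T(1) by blast+
    moreover have "card (h ` S) = card S"
      by (rule card_image[OF inj_on_subset[OF permutes_inj[OF h(1)]]]) simp
    ultimately have "h ` S = T"
      using K(2) h(2) finite_subset[OF T(1)] by (intro card_seteq) auto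
    then show ?thesis
      unfolding S T W_conj_iff[OF S(1) T(1)] using h by blast
  qed
  then show ?thesis using nonzero by blast
qed

text \<open>For linear independence, take a class with nonzero coefficient whose representative is as large as possible and
  evaluate the relation at its separating element: only the term of that class survives.\<close>

sublocale mackey_characters \<Phi> \<Delta>
proof
  show "finite \<Delta>" by (simp add: simple_roots_eq)
next
  fix J K assume "J \<subseteq> \<Delta>" "K \<subseteq> \<Delta>" "x_class \<Phi> \<Delta> J = x_class \<Phi> \<Delta> K"
  then show "perm_char \<Phi> J = perm_char \<Phi> K"
    using perm_char_W_conj x_class_eq_iff by blast
next
  fix u c
  assume zero: "\<And>w. (\<Sum>c\<in>x_classes \<Phi> \<Delta>. u c * perm_char \<Phi> (class_rep \<Phi> \<Delta> c) w) = 0"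
    and c: "c \<in> x_classes \<Phi> \<Delta>"
  let ?rep = "class_rep \<Phi> \<Delta>"
  have rep: "?rep c \<subseteq> \<Delta> \<and> x_class \<Phi> \<Delta> (?rep c) = c" if "c \<in> x_classes \<Phi> \<Delta>" for c
    using class_rep[OF that] by blast
  have fin: "finite (x_classes \<Phi> \<Delta>)" by (simp add: x_classes_def simple_roots_eq)
  show "u c = 0"
  proof (rule ccontr)
    assume "u c \<noteq> 0"
    define X where "X = {d \<in> x_classes \<Phi> \<Delta>. u d \<noteq> 0}"
    have "finite X" "X \<noteq> {}" using fin c \<open>u c \<noteq> 0\<close> by (auto simp: X_def)
    then have "Max ((\<lambda>d. card (?rep d)) ` X) \<in> (\<lambda>d. card (?rep d)) ` X"
      and max: "\<And>d. d \<in> X \<Longrightarrow> card (?rep d) \<le> Max ((\<lambda>d. card (?rep d)) ` X)"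
      by auto
    then obtain b where b: "b \<in> X" "\<And>d. d \<in> X \<Longrightarrow> card (?rep d) \<le> card (?rep b)" by auto
    have bc: "b \<in> x_classes \<Phi> \<Delta>" using b(1) by (simp add: X_def)
    obtain w where w: "perm_char \<Phi> (?rep b) w \<noteq> 0"
      "\<forall>K\<subseteq>\<Delta>. card K \<le> card (?rep b) \<longrightarrow> perm_char \<Phi> K w \<noteq> 0 \<longrightarrow> W_conj \<Phi> (?rep b) K"
      using ex_char_separating_element rep[OF bc] by blast
    have "u d * perm_char \<Phi> (?rep d) w = 0" if d: "d \<in> x_classes \<Phi> \<Delta> - {b}" for d
    proof (rule ccontr)
      assume "u d * perm_char \<Phi> (?rep d) w \<noteq> 0"
      then have "W_conj \<Phi> (?rep b) (?rep d)"
        using w(2) b(2)[of d] d rep[of d] by (auto simp: X_def)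
      then have "b = d" using x_class_eq_iff[of "?rep b" "?rep d"] rep[OF bc] rep[of d] d by auto
      then show False using d by simp
    qed
    then have "(\<Sum>d\<in>x_classes \<Phi> \<Delta> - {b}. u d * perm_char \<Phi> (?rep d) w) = 0"
      by (rule sum.neutral[OF ballI])
    then have "(\<Sum>d\<in>x_classes \<Phi> \<Delta>. u d * perm_char \<Phi> (?rep d) w) = u b * perm_char \<Phi> (?rep b) w"
      unfolding sum.remove[OF fin bc] by simp
    then show False using zero[of w] w(1) b(1) by (simp add: X_def)
  qed
qed (fact perm_char_product perm_char_all_simple)+

end

theorem proposition2p12:
  fixes e :: "nat \<Rightarrow> 'a::euclidean_space" and n :: nat and \<Phi> \<Delta> :: "'a set"
  assumes dim: "DIM('a) = n + 1"
    and orthonormal: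
      "\<forall>i\<in>{1..n+1}. \<forall>j\<in>{1..n+1}. e i \<bullet> e j = (if i = j then 1 else 0)"
    and Phi: "\<Phi> = typeA_roots e n"
    and Delta: "\<Delta> = typeA_simple e n"
  shows
    "Module.algebra rat_ring (new_descent_algebra \<Phi> \<Delta>) \<and>
     (\<forall>J K. J \<subseteq> \<Delta> \<and> K \<subseteq> \<Delta> \<longrightarrow>
        class_vec \<Phi> \<Delta> J \<otimes>\<^bsub>new_descent_algebra \<Phi> \<Delta>\<^esub> class_vec \<Phi> \<Delta> K = class_prod \<Phi> \<Delta> J K) \<and>
     Module.algebra rat_ring (perm_char_algebra \<Phi> \<Delta>) \<and>
     subring (perm_char_span \<int> \<Phi> \<Delta>) (perm_char_algebra \<Phi> \<Delta>) \<and>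
     (\<exists>\<psi>\<in>linear_maps rat_ring (new_descent_algebra \<Phi> \<Delta>) (perm_char_algebra \<Phi> \<Delta>).
        \<forall>J. J \<subseteq> \<Delta> \<longrightarrow> \<psi> (class_vec \<Phi> \<Delta> J) = perm_char \<Phi> J) \<and>
     (\<forall>\<psi>\<in>linear_maps rat_ring (new_descent_algebra \<Phi> \<Delta>) (perm_char_algebra \<Phi> \<Delta>).
        (\<forall>J. J \<subseteq> \<Delta> \<longrightarrow> \<psi> (class_vec \<Phi> \<Delta> J) = perm_char \<Phi> J) \<longrightarrow>
        \<psi> \<in> ring_iso (new_descent_algebra \<Phi> \<Delta>) (perm_char_algebra \<Phi> \<Delta>) \<and>
        \<psi> ` {u \<in> carrier (new_descent_algebra \<Phi> \<Delta>). \<forall>c. u c \<in> \<int>} = perm_char_span \<int> \<Phi> \<Delta>)"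
proof -
  interpret type_A e "n + 1" \<Phi> \<Delta>
  proof
    have "{1..n} = {1..<n + 1}" by auto
    then show "\<Delta> = (\<lambda>i. e i - e (Suc i)) ` {1..<n + 1}"
      unfolding Delta typeA_simple_def by auto
  qed (use dim orthonormal Phi in \<open>simp_all only: typeA_roots_def\<close>)
  show ?thesis by (rule descent_algebra_iso_characters)
qed

end
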